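(* Let $\mathbf{A}_3$ be the minimal subalgebra of the full relation algebra on a 3-element set, and let $\operatorname{Var}(\mathbf{A}_3)$ be the variety it generates. Then $\operatorname{Var}(\mathbf{A}_3)$ has exactly $2^{\aleph_0}$ join-irreducible covers in each of the lattices $\boldsymbol{\Lambda}_{\mathrm{RSA}}$, $\boldsymbol{\Lambda}_{\mathrm{SA}}$ and $\boldsymbol{\Lambda}_{\mathrm{NA}}$ (the subvariety lattices of the varieties of reflexive subadditive symmetric semiassociative relation algebras, of semiassociative relation algebras, and of nonassociative relation algebras, respectively).
   Context: A nonassociative relation algebra is an algebra $\mathbf{A}=\langle A;\vee,\wedge,\cdot,{}',\breve{\ },0,1,e\rangle$ such that $\langle A;\vee,\wedge,{}',0,1\rangle$ is a Boolean algebra, $\cdot$ is a binary operation, $e$ is an identity element for $\cdot$, and for all $x,y,z\in A$ the triangle laws hold: $(x\cdot y)\wedge z=0 \iff (\breve{x}\cdot z)\wedge y=0\iff (z\cdot\breve{y})\wedge x=0$. It is semiassociative if it satisfies $(x\cdot 1)\cdot 1\approx x\cdot 1$; reflexive if $x\le x\cdot x$ for all $x$; symmetric if $\breve{x}\approx x$; subadditive if $x\cdot(x'\wedge y)\le x\vee y$ for all $x,y$. The classes of all nonassociative relation algebras, all semiassociative relation algebras, and all reflexive subadditive symmetric semiassociative relation algebras are varieties; their lattices of subvarieties are denoted $\boldsymbol{\Lambda}_{\mathrm{NA}}$, $\boldsymbol{\Lambda}_{\mathrm{SA}}$, $\boldsymbol{\Lambda}_{\mathrm{RSA}}$. The full relation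 algebra on a set $U$ is the algebra of all subsets of $U\times U$ with union, intersection, relational composition, complement, relational converse, $\varnothing$, $U\times U$ and the identity relation on $U$; its minimal subalgebra is the subalgebra generated by $\varnothing$. In a lattice, $b$ covers $a$ if $a<b$ and there is no $c$ with $a<c<b$; a non-bottom element $b$ is join-irreducible if $b=c\vee d$ implies $b=c$ or $b=d$. *)

theory Defs
  imports
    "HOL-Algebra.Lattice"
    "HOL-Library.Equipollence"
    "HOL-Library.Infinite_Typeclass"
begin

record 'a ra = "'a partial_object" +
  ra_join :: "'a \<Rightarrow> 'a \<Rightarrow> 'a" (infixl "\<^bold>\<or>\<index>" 65)
  ra_meet :: "'a \<Rightarrow> 'a \<Rightarrow> 'a" (infixl "\<^bold>\<and>\<index>" 70)
  ra_comp :: "'a \<Rightarrow> 'a \<Rightarrow> 'a" (infixl "\<bullet>\<index>" 75)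
  ra_compl :: "'a \<Rightarrow> 'a" ("\<sim>\<index> _" [81] 80)
  ra_conv :: "'a \<Rightarrow> 'a" ("\<smile>\<index> _" [81] 80)
  ra_zero :: "'a" ("\<zero>\<index>")
  ra_one :: "'a" ("\<one>\<index>")
  ra_id :: "'a" ("\<e>\<index>")


subsection \<open>Subalgebras\<close>

definition subuniverse :: "'a ra \<Rightarrow> 'a set \<Rightarrow> bool" where
  "subuniverse A S \<longleftrightarrow> S \<subseteq> carrier A
     \<and> \<zero>\<^bsub>A\<^esub> \<in> S \<and> \<one>\<^bsub>A\<^esub> \<in> S \<and> \<e>\<^bsub>A\<^esub> \<in> S
     \<and> (\<forall>x\<in>S. \<sim>\<^bsub>A\<^esub> x \<in> S \<and> \<smile>\<^bsub>A\<^esub> x \<in> S)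
     \<and> (\<forall>x\<in>S. \<forall>y\<in>S. x \<^bold>\<or>\<^bsub>A\<^esub> y \<in> S \<and> x \<^bold>\<and>\<^bsub>A\<^esub> y \<in> S \<and> x \<bullet>\<^bsub>A\<^esub> y \<in> S)"

definition algebra :: "'a ra \<Rightarrow> bool" where
  "algebra A \<longleftrightarrow> subuniverse A (carrier A)"

definition generated_subalgebra :: "'a ra \<Rightarrow> 'a set \<Rightarrow> 'a ra" where
  "generated_subalgebra A X = A\<lparr>carrier := \<Inter>{S. subuniverse A S \<and> X \<subseteq> S}\<rparr>"


subsection \<open>Identities and varieties\<close>

datatype trm =
    Var nat
  | Join trm trm | Meet trm trm | Comp trm trm
  | Compl trm | Conv trm
  | Zero | One | Ident

primrec eval :: "'a ra \<Rightarrow> (nat \<Rightarrow> 'a) \<Rightarrow> trm \<Rightarrow> 'a" where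
  "eval A \<rho> (Var n) = \<rho> n"
| "eval A \<rho> (Join s t) = eval A \<rho> s \<^bold>\<or>\<^bsub>A\<^esub> eval A \<rho> t"
| "eval A \<rho> (Meet s t) = eval A \<rho> s \<^bold>\<and>\<^bsub>A\<^esub> eval A \<rho> t"
| "eval A \<rho> (Comp s t) = eval A \<rho> s \<bullet>\<^bsub>A\<^esub> eval A \<rho> t"
| "eval A \<rho> (Compl t) = \<sim>\<^bsub>A\<^esub> eval A \<rho> t"
| "eval A \<rho> (Conv t) = \<smile>\<^bsub>A\<^esub> eval A \<rho> t"
| "eval A \<rho> Zero = \<zero>\<^bsub>A\<^esub>"
| "eval A \<rho> One = \<one>\<^bsub>A\<^esub>"
| "eval A \<rho> Ident = \<e>\<^bsub>A\<^esub>"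

definition satisfies :: "'a ra \<Rightarrow> trm \<times> trm \<Rightarrow> bool" where
  "satisfies A p \<longleftrightarrow>
     (\<forall>\<rho>. range \<rho> \<subseteq> carrier A \<longrightarrow> eval A \<rho> (fst p) = eval A \<rho> (snd p))"

text \<open>
  A variety is an equationally definable class. In HOL the members of a class have
  their carriers inside one type \<open>'a\<close>. If \<open>'a\<close> is infinite this loses nothing:
  the signature is countable, so every variety is determined by its countable members
  (already by its free algebra on countably many generators), and inclusion of varieties
  is inclusion of their sets of members over \<open>'a\<close>.
\<close>

definition models :: "(trm \<times> trm) set \<Rightarrow> 'a ra set" where
  "models E = {A. algebra A \<and> (\<forall>p\<in>E. satisfies A p)}"

definition variety :: "'a ra set \<Rightarrow> bool" where
  "variety V \<longleftrightarrow> (\<exists>E. V = models E)"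

text \<open>
  The least variety containing \<open>A\<close>. The carrier type \<open>'b\<close> of the generating algebra
  need not be the type \<open>'a\<close> over which the members of the variety range, hence the
  indirection via the sets of identities that define the varieties containing \<open>A\<close>.
\<close>

definition variety_generated_by :: "'b ra \<Rightarrow> 'a ra set" where
  "variety_generated_by A = \<Inter>{models E | E. A \<in> models E}"


subsection \<open>Nonassociative relation algebras\<close>

locale boolean_reduct =
  fixes A :: "'a ra" (structure)
  assumes algebra: "algebra A"
    and join_assoc:
      "\<lbrakk>x \<in> carrier A; y \<in> carrier A; z \<in> carrier A\<rbrakk> \<Longrightarrow> (x \<^bold>\<or> y) \<^bold>\<or> z = x \<^bold>\<or> (y \<^bold>\<or> z)"
    and meet_assoc:
      "\<lbrakk>x \<in> carrier A; y \<in> carrier A; z \<in> carrier A\<rbrakk> \<Longrightarrow> (x \<^bold>\<and> y) \<^bold>\<and> z = x \<^bold>\<and> (y \<^bold>\<and> z)"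
    and join_comm: "\<lbrakk>x \<in> carrier A; y \<in> carrier A\<rbrakk> \<Longrightarrow> x \<^bold>\<or> y = y \<^bold>\<or> x"
    and meet_comm: "\<lbrakk>x \<in> carrier A; y \<in> carrier A\<rbrakk> \<Longrightarrow> x \<^bold>\<and> y = y \<^bold>\<and> x"
    and join_absorb: "\<lbrakk>x \<in> carrier A; y \<in> carrier A\<rbrakk> \<Longrightarrow> x \<^bold>\<or> (x \<^bold>\<and> y) = x"
    and meet_absorb: "\<lbrakk>x \<in> carrier A; y \<in> carrier A\<rbrakk> \<Longrightarrow> x \<^bold>\<and> (x \<^bold>\<or> y) = x"
    and meet_join_distrib:
      "\<lbrakk>x \<in> carrier A; y \<in> carrier A; z \<in> carrier A\<rbrakk>
        \<Longrightarrow> x \<^bold>\<and> (y \<^bold>\<or> z) = (x \<^bold>\<and> y) \<^bold>\<or> (x \<^bold>\<and> z)"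
    and join_zero: "x \<in> carrier A \<Longrightarrow> x \<^bold>\<or> \<zero> = x"
    and meet_one: "x \<in> carrier A \<Longrightarrow> x \<^bold>\<and> \<one> = x"
    and join_compl: "x \<in> carrier A \<Longrightarrow> x \<^bold>\<or> \<sim> x = \<one>"
    and meet_compl: "x \<in> carrier A \<Longrightarrow> x \<^bold>\<and> \<sim> x = \<zero>"

definition ra_le :: "'a ra \<Rightarrow> 'a \<Rightarrow> 'a \<Rightarrow> bool" (infix "\<preceq>\<index>" 50) where
  "x \<preceq>\<^bsub>A\<^esub> y \<longleftrightarrow> x \<^bold>\<and>\<^bsub>A\<^esub> y = x"

locale nonassociative_relation_algebra = boolean_reduct +
  assumes id_comp: "x \<in> carrier A \<Longrightarrow> \<e> \<bullet> x = x"
    and comp_id: "x \<in> carrier A \<Longrightarrow> x \<bullet> \<e> = x"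
    and triangle1:
      "\<lbrakk>x \<in> carrier A; y \<in> carrier A; z \<in> carrier A\<rbrakk>
        \<Longrightarrow> (x \<bullet> y) \<^bold>\<and> z = \<zero> \<longleftrightarrow> ((\<smile> x) \<bullet> z) \<^bold>\<and> y = \<zero>"
    and triangle2:
      "\<lbrakk>x \<in> carrier A; y \<in> carrier A; z \<in> carrier A\<rbrakk>
        \<Longrightarrow> ((\<smile> x) \<bullet> z) \<^bold>\<and> y = \<zero> \<longleftrightarrow> (z \<bullet> (\<smile> y)) \<^bold>\<and> x = \<zero>"

locale semiassociative_relation_algebra = nonassociative_relation_algebra +
  assumes semiassociative: "x \<in> carrier A \<Longrightarrow> (x \<bullet> \<one>) \<bullet> \<one> = x \<bullet> \<one>"

locale reflexive_subadditive_symmetric_semiassociative_relation_algebra =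
  semiassociative_relation_algebra +
  assumes reflexive: "x \<in> carrier A \<Longrightarrow> x \<preceq> x \<bullet> x"
    and subadditive:
      "\<lbrakk>x \<in> carrier A; y \<in> carrier A\<rbrakk> \<Longrightarrow> x \<bullet> ((\<sim> x) \<^bold>\<and> y) \<preceq> x \<^bold>\<or> y"
    and symmetric: "x \<in> carrier A \<Longrightarrow> \<smile> x = x"

definition NA :: "'a ra set" where
  "NA = {A. nonassociative_relation_algebra A}"

definition SA :: "'a ra set" where
  "SA = {A. semiassociative_relation_algebra A}"

definition RSA :: "'a ra set" where
  "RSA = {A. reflexive_subadditive_symmetric_semiassociative_relation_algebra A}"


subsection \<open>Relation algebras of binary relations\<close>

definition full_relation_algebra :: "'u set \<Rightarrow> ('u \<times> 'u) set ra" where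
  "full_relation_algebra U =
     \<lparr>carrier = Pow (U \<times> U),
      ra_join = (\<union>), ra_meet = (\<inter>), ra_comp = (O),
      ra_compl = (\<lambda>R. (U \<times> U) - R), ra_conv = converse,
      ra_zero = {}, ra_one = U \<times> U, ra_id = Id_on U\<rparr>"

definition minimal_relation_algebra :: "'u set \<Rightarrow> ('u \<times> 'u) set ra" where
  "minimal_relation_algebra U = generated_subalgebra (full_relation_algebra U) {}"


subsection \<open>Lattices of subvarieties\<close>

definition subvariety_lattice :: "'a ra set \<Rightarrow> 'a ra set gorder" where
  "subvariety_lattice K = \<lparr>carrier = {V. variety V \<and> V \<subseteq> K}, eq = (=), le = (\<subseteq>)\<rparr>"

definition covers :: "('a, 'b) gorder_scheme \<Rightarrow> 'a \<Rightarrow> 'a \<Rightarrow> bool" where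
  "covers L b a \<longleftrightarrow> a \<in> carrier L \<and> b \<in> carrier L \<and> a \<sqsubset>\<^bsub>L\<^esub> b
     \<and> \<not> (\<exists>c\<in>carrier L. a \<sqsubset>\<^bsub>L\<^esub> c \<and> c \<sqsubset>\<^bsub>L\<^esub> b)"

definition join_irreducible :: "('a, 'b) gorder_scheme \<Rightarrow> 'a \<Rightarrow> bool" where
  "join_irreducible L b \<longleftrightarrow> b \<in> carrier L \<and> b \<noteq> \<bottom>\<^bsub>L\<^esub>
     \<and> (\<forall>c\<in>carrier L. \<forall>d\<in>carrier L. b = c \<squnion>\<^bsub>L\<^esub> d \<longrightarrow> b = c \<or> b = d)"

definition join_irreducible_covers :: "('a, 'b) gorder_scheme \<Rightarrow> 'a \<Rightarrow> 'a set" where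
  "join_irreducible_covers L a = {b. covers L b a \<and> join_irreducible L b}"

end

theory Submission
  imports Defs "HOL-Analysis.Abstract_Topology_2"
begin

text \<open>
  A reflexive total graph \<open>R\<close> on a vertex set gives an algebra in \<open>RSA\<close> whose atoms are \<open>e\<close> and the
  vertices, a triple \<open>x, x, z\<close> of vertices being a cycle iff \<open>R x z\<close>. For \<open>0 < \<theta> < 1/2\<close> take the
  real line and let \<open>R x y\<close> fail iff \<open>0 < y - x < \<theta>\<close> or \<open>1 \<le> y - x\<close>; let \<open>B\<close> be the subalgebra
  generated by the ray \<open>[0, \<infinity>)\<close>. The operator \<open>F X = {z. \<forall>x\<in>X. \<not> R x z}\<close> and its dual are term
  functions, and \<open>P X = F (- F X)\<close> (\<open>ray_beyond\<close>) is the ray \<open>[Sup X + 2, \<infinity>)\<close> if \<open>X\<close> is nonempty and bounded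
  above. All members of \<open>B\<close> are eventually constant towards \<open>\<infinity>\<close>, so that for every element \<open>X\<close>
  of \<open>B\<close> outside the four-element subalgebra one of \<open>P X\<close>, \<open>P (- X)\<close> is a ray. Translations are
  automorphisms, hence such an \<open>X\<close> generates a copy of \<open>B\<close>, uniformly in \<open>X\<close>. As \<open>1 x 1 = 1\<close> for
  all nonzero \<open>x\<close>, this can be expressed by identities, and it follows that all proper subvarieties of
  the variety of \<open>B\<close> are contained in that of \<open>A\<^sub>3\<close>. Different \<open>\<theta>\<close> give different varieties: two terms
  move the ray at \<open>c\<close> to the rays at \<open>c + 2\<close> and \<open>c + 2 + \<theta>\<close>, and the inclusions between their
  iterates determine \<open>\<theta>\<close>.
\<close>

section \<open>Identities and free algebras\<close>

primrec subst :: "(nat \<Rightarrow> trm) \<Rightarrow> trm \<Rightarrow> trm" where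
  "subst \<sigma> (Var n) = \<sigma> n"
| "subst \<sigma> (Join s t) = Join (subst \<sigma> s) (subst \<sigma> t)"
| "subst \<sigma> (Meet s t) = Meet (subst \<sigma> s) (subst \<sigma> t)"
| "subst \<sigma> (Comp s t) = Comp (subst \<sigma> s) (subst \<sigma> t)"
| "subst \<sigma> (Compl t) = Compl (subst \<sigma> t)"
| "subst \<sigma> (Conv t) = Conv (subst \<sigma> t)"
| "subst \<sigma> Zero = Zero"
| "subst \<sigma> One = One"
| "subst \<sigma> Ident = Ident"

lemma eval_subst: "eval A \<rho> (subst \<sigma> t) = eval A (\<lambda>n. eval A \<rho> (\<sigma> n)) t"
  by (induction t) auto

lemma subst_Var: "subst Var t = t"
  by (induction t) auto

lemma eval_carrier_update: "eval (A\<lparr>carrier := S\<rparr>) \<rho> t = eval A \<rho> t"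
  by (induction t) auto

lemma eval_in_subuniverse:
  assumes "subuniverse A S" "range \<rho> \<subseteq> S"
  shows "eval A \<rho> t \<in> S"
  using assms by (induction t) (auto simp: subuniverse_def)

lemma eval_closed:
  assumes "algebra A" "range \<rho> \<subseteq> carrier A"
  shows "eval A \<rho> t \<in> carrier A"
  using assms eval_in_subuniverse unfolding algebra_def by blast

text \<open>Only finitely many variables occur in a term. The bound makes it possible to write a
  disjunction over all variables of an identity as a single join.\<close>

lemma finitely_many_variables:
  "\<exists>N. \<forall>\<rho> \<rho>'. (\<forall>i<N. \<rho> i = \<rho>' i) \<longrightarrow> eval A \<rho> t = eval A \<rho>' t"
proof (induction t)
  case (Var n)
  show ?case by (rule exI[of _ "Suc n"]) auto
next
  case (Join s t)
  then obtain M N where "\<forall>\<rho> \<rho>'. (\<forall>i<M. \<rho> i = \<rho>' i) \<longrightarrow> eval A \<rho> s = eval A \<rho>' s"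
    "\<forall>\<rho> \<rho>'. (\<forall>i<N. \<rho> i = \<rho>' i) \<longrightarrow> eval A \<rho> t = eval A \<rho>' t" by blast
  then show ?case by (intro exI[of _ "M + N"]) (metis eval.simps(2) trans_less_add1 trans_less_add2)
next
  case (Meet s t)
  then obtain M N where "\<forall>\<rho> \<rho>'. (\<forall>i<M. \<rho> i = \<rho>' i) \<longrightarrow> eval A \<rho> s = eval A \<rho>' s"
    "\<forall>\<rho> \<rho>'. (\<forall>i<N. \<rho> i = \<rho>' i) \<longrightarrow> eval A \<rho> t = eval A \<rho>' t" by blast
  then show ?case by (intro exI[of _ "M + N"]) (metis eval.simps(3) trans_less_add1 trans_less_add2)
next
  case (Comp s t)
  then obtain M N where "\<forall>\<rho> \<rho>'. (\<forall>i<M. \<rho> i = \<rho>' i) \<longrightarrow> eval A \<rho> s = eval A \<rho>' s"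
    "\<forall>\<rho> \<rho>'. (\<forall>i<N. \<rho> i = \<rho>' i) \<longrightarrow> eval A \<rho> t = eval A \<rho>' t" by blast
  then show ?case by (intro exI[of _ "M + N"]) (metis eval.simps(4) trans_less_add1 trans_less_add2)
qed (metis eval.simps)+

definition identities :: "'a ra \<Rightarrow> (trm \<times> trm) set" where
  "identities A = {p. satisfies A p}"

lemma in_models_iff: "A \<in> models E \<longleftrightarrow> algebra A \<and> E \<subseteq> identities A"
  by (auto simp: models_def identities_def)

lemma models_antimono: "E \<subseteq> E' \<Longrightarrow> models E' \<subseteq> models E"
  by (auto simp: models_def)

lemma identitiesD:
  "\<lbrakk>(s, t) \<in> identities A; range \<rho> \<subseteq> carrier A\<rbrakk> \<Longrightarrow> eval A \<rho> s = eval A \<rho> t"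
  by (auto simp: identities_def satisfies_def)

lemma identitiesI:
  "(\<And>\<rho>. range \<rho> \<subseteq> carrier A \<Longrightarrow> eval A \<rho> s = eval A \<rho> t) \<Longrightarrow> (s, t) \<in> identities A"
  by (auto simp: identities_def satisfies_def)

lemma identities_subst:
  assumes "algebra A" "(s, t) \<in> identities A"
  shows "(subst \<sigma> s, subst \<sigma> t) \<in> identities A"
proof (rule identitiesI)
  fix \<rho> :: "nat \<Rightarrow> _" assume "range \<rho> \<subseteq> carrier A"
  then have "range (\<lambda>n. eval A \<rho> (\<sigma> n)) \<subseteq> carrier A"
    using eval_closed[OF assms(1)] by blast
  then show "eval A \<rho> (subst \<sigma> s) = eval A \<rho> (subst \<sigma> t)"
    unfolding eval_subst by (rule identitiesD[OF assms(2)])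
qed

text \<open>\<open>identities A\<close> is the largest set of equations that \<open>A\<close>
  satisfies and \<open>models\<close> is antitone, so the intersection is attained at it.\<close>

lemma variety_generated_by_eq:
  assumes "algebra A"
  shows "variety_generated_by A = models (identities A)"
proof
  show "variety_generated_by A \<subseteq> models (identities A)"
    using assms unfolding variety_generated_by_def by (intro Inter_lower) (auto simp: in_models_iff)
  show "models (identities A) \<subseteq> variety_generated_by A"
    unfolding variety_generated_by_def
    by (rule Inter_greatest) (auto simp: in_models_iff dest: models_antimono)
qed

instance trm :: countable
  by countable_datatype

text \<open>
  The free algebra on countably many generators in the variety of \<open>A\<close> consists of terms modulo the
  identities of \<open>A\<close>; choosing representatives, it fits into any infinite type.
\<close>

lemma ex_algebra_with_identities:
  fixes A :: "'b ra"
  assumes A: "algebra A"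
  obtains C :: "'a::infinite ra" where "algebra C" "identities C = identities A"
proof -
  obtain f :: "nat \<Rightarrow> 'a" where "inj f"
    using infinite_countable_subset[OF infinite_UNIV] by blast
  define \<phi> :: "trm \<Rightarrow> 'a" where "\<phi> = f \<circ> to_nat"
  have \<phi>: "inj \<phi>" using \<open>inj f\<close> by (auto simp: \<phi>_def intro: inj_compose)
  define rep where "rep t = (SOME s. (t, s) \<in> identities A)" for t
  have refl: "(t, t) \<in> identities A" for t by (auto intro: identitiesI)
  have sym: "(t, s) \<in> identities A" if "(s, t) \<in> identities A" for s t
    using that by (simp add: identities_def satisfies_def)
  have trans: "(s, u) \<in> identities A" if "(s, t) \<in> identities A" "(t, u) \<in> identities A" for s t u
    using that by (simp add: identities_def satisfies_def)
  have rep: "(t, rep t) \<in> identities A" for t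
    unfolding rep_def by (rule someI[of _ t]) (rule refl)
  have rep_eq: "rep s = rep t \<longleftrightarrow> (s, t) \<in> identities A" for s t
  proof
    assume "rep s = rep t" then show "(s, t) \<in> identities A" using rep sym trans by metis
  next
    assume "(s, t) \<in> identities A"
    \<comment> \<open>Equivalent terms define the same predicate, so the choice operator returns the
      same representative for both.\<close>
    then have "(\<lambda>u. (s, u) \<in> identities A) = (\<lambda>u. (t, u) \<in> identities A)"
      using sym trans by blast
    then show "rep s = rep t" by (simp add: rep_def)
  qed
  define \<kappa> where "\<kappa> t = \<phi> (rep t)" for t
  have \<kappa>_eq: "\<kappa> s = \<kappa> t \<longleftrightarrow> (s, t) \<in> identities A" for s t
    using \<phi> rep_eq by (auto simp: \<kappa>_def inj_eq)
  define d where "d x = (SOME t. \<kappa> t = x)" for x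
  have "\<kappa> (d (\<kappa> t)) = \<kappa> t" for t
    unfolding d_def by (rule someI[of _ t]) (rule HOL.refl)
  then have d: "(d (\<kappa> t), t) \<in> identities A" for t using \<kappa>_eq by blast
  define C :: "'a ra" where "C = \<lparr>carrier = range \<kappa>,
     ra_join = (\<lambda>x y. \<kappa> (Join (d x) (d y))), ra_meet = (\<lambda>x y. \<kappa> (Meet (d x) (d y))),
     ra_comp = (\<lambda>x y. \<kappa> (Comp (d x) (d y))), ra_compl = (\<lambda>x. \<kappa> (Compl (d x))),
     ra_conv = (\<lambda>x. \<kappa> (Conv (d x))), ra_zero = \<kappa> Zero, ra_one = \<kappa> One, ra_id = \<kappa> Ident\<rparr>"
  have C: "carrier C = range \<kappa>" "\<zero>\<^bsub>C\<^esub> = \<kappa> Zero" "\<one>\<^bsub>C\<^esub> = \<kappa> One" "\<e>\<^bsub>C\<^esub> = \<kappa> Ident"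
    "\<kappa> s \<^bold>\<or>\<^bsub>C\<^esub> \<kappa> t = \<kappa> (Join s t)" "\<kappa> s \<^bold>\<and>\<^bsub>C\<^esub> \<kappa> t = \<kappa> (Meet s t)" "\<kappa> s \<bullet>\<^bsub>C\<^esub> \<kappa> t = \<kappa> (Comp s t)"
    "\<sim>\<^bsub>C\<^esub> \<kappa> t = \<kappa> (Compl t)" "\<smile>\<^bsub>C\<^esub> \<kappa> t = \<kappa> (Conv t)" for s t
    unfolding C_def using d[of s] d[of t]
    by (simp_all add: \<kappa>_eq identities_def satisfies_def)
  have alg: "algebra C" by (auto simp: algebra_def subuniverse_def C)
  \<comment> \<open>Evaluation at classes of terms is substitution. With
    \<open>\<sigma> = Var\<close> an identity of \<open>C\<close> becomes one of \<open>A\<close>;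
    conversely \<open>identities A\<close> is closed under substitution.\<close>
  have ev: "eval C (\<lambda>n. \<kappa> (\<sigma> n)) t = \<kappa> (subst \<sigma> t)" for \<sigma> t
    by (induction t) (simp_all add: C)
  have "(s, t) \<in> identities C \<longleftrightarrow> (s, t) \<in> identities A" for s t
  proof
    assume "(s, t) \<in> identities C"
    moreover have "range (\<lambda>n. \<kappa> (Var n)) \<subseteq> carrier C" by (auto simp: C)
    ultimately have "\<kappa> (subst Var s) = \<kappa> (subst Var t)"
      unfolding ev[symmetric] by (rule identitiesD)
    then show "(s, t) \<in> identities A" by (simp add: subst_Var \<kappa>_eq)
  next
    assume st: "(s, t) \<in> identities A"
    show "(s, t) \<in> identities C"
    proof (rule identitiesI)
      fix \<rho> :: "nat \<Rightarrow> _" assume "range \<rho> \<subseteq> carrier C"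
      then have "\<forall>n. \<exists>u. \<rho> n = \<kappa> u" by (auto simp: C)
      then obtain \<sigma> where "\<rho> = (\<lambda>n. \<kappa> (\<sigma> n))" by metis
      then show "eval C \<rho> s = eval C \<rho> t"
        using identities_subst[OF A st, of \<sigma>] by (simp add: ev \<kappa>_eq)
    qed
  qed
  then have "identities C = identities A" by auto
  with alg show thesis by (rule that)
qed

section \<open>Homomorphisms and the transfer of identities\<close>

definition ra_hom :: "'a ra \<Rightarrow> 'b ra \<Rightarrow> ('a \<Rightarrow> 'b) \<Rightarrow> bool" where
  "ra_hom A B h \<longleftrightarrow> (\<forall>x\<in>carrier A. h x \<in> carrier B)
     \<and> h \<zero>\<^bsub>A\<^esub> = \<zero>\<^bsub>B\<^esub> \<and> h \<one>\<^bsub>A\<^esub> = \<one>\<^bsub>B\<^esub> \<and> h \<e>\<^bsub>A\<^esub> = \<e>\<^bsub>B\<^esub>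
     \<and> (\<forall>x\<in>carrier A. h (\<sim>\<^bsub>A\<^esub> x) = \<sim>\<^bsub>B\<^esub> h x \<and> h (\<smile>\<^bsub>A\<^esub> x) = \<smile>\<^bsub>B\<^esub> h x)
     \<and> (\<forall>x\<in>carrier A. \<forall>y\<in>carrier A. h (x \<^bold>\<or>\<^bsub>A\<^esub> y) = h x \<^bold>\<or>\<^bsub>B\<^esub> h y
          \<and> h (x \<^bold>\<and>\<^bsub>A\<^esub> y) = h x \<^bold>\<and>\<^bsub>B\<^esub> h y \<and> h (x \<bullet>\<^bsub>A\<^esub> y) = h x \<bullet>\<^bsub>B\<^esub> h y)"

lemma eval_hom:
  assumes "ra_hom A B h" "algebra A" "range \<rho> \<subseteq> carrier A"
  shows "eval B (\<lambda>n. h (\<rho> n)) t = h (eval A \<rho> t)"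
  using assms eval_closed[OF assms(2,3)] by (induction t) (simp_all add: ra_hom_def)

lemma identities_of_embedded:
  assumes "ra_hom A B h" "algebra A" "inj_on h (carrier A)"
  shows "identities B \<subseteq> identities A"
proof clarify
  fix s t assume st: "(s, t) \<in> identities B"
  show "(s, t) \<in> identities A"
  proof (rule identitiesI)
    fix \<rho> :: "nat \<Rightarrow> _" assume \<rho>: "range \<rho> \<subseteq> carrier A"
    then have "range (\<lambda>n. h (\<rho> n)) \<subseteq> carrier B" using assms(1) by (auto simp: ra_hom_def)
    then have "h (eval A \<rho> s) = h (eval A \<rho> t)"
      using identitiesD[OF st] by (metis eval_hom[OF assms(1,2) \<rho>])
    then show "eval A \<rho> s = eval A \<rho> t"
      using assms(3) eval_closed[OF assms(2) \<rho>] by (simp add: inj_on_eq_iff)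
  qed
qed

text \<open>The valuation lifts pointwise along \<open>h\<close>. Only its values have to lie in the
  image, so this applies even if \<open>B\<close> violates the identity elsewhere.\<close>

lemma eval_eq_in_hom_image:
  assumes "ra_hom A B h" "algebra A" "(s, t) \<in> identities A" "range \<rho> \<subseteq> h ` carrier A"
  shows "eval B \<rho> s = eval B \<rho> t"
proof -
  have "\<forall>n. \<exists>x. x \<in> carrier A \<and> \<rho> n = h x" using assms(4) by auto
  then obtain \<tau> where \<tau>: "\<And>n. \<tau> n \<in> carrier A" "\<rho> = (\<lambda>n. h (\<tau> n))" by metis
  then show ?thesis
    using eval_hom[OF assms(1,2), of \<tau>] identitiesD[OF assms(3), of \<tau>] by (simp add: image_subset_iff)
qed

lemma identities_of_image:
  assumes "ra_hom A B h" "algebra A" "h ` carrier A = carrier B"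
  shows "identities A \<subseteq> identities B"
  using eval_eq_in_hom_image[OF assms(1,2)] assms(3) by (auto intro: identitiesI)

section \<open>Equational axioms\<close>

text \<open>The last four equations encode the four implications in the triangle laws: a hypothesis
  that \<open>u\<close> is disjoint from \<open>w\<close> is absorbed by replacing \<open>u\<close>
  with its part outside \<open>w\<close>.\<close>

definition NA_axioms :: "(trm \<times> trm) set" where
  "NA_axioms = (let x = Var 0; y = Var 1; z = Var 2 in
    {(Join (Join x y) z, Join x (Join y z)), (Meet (Meet x y) z, Meet x (Meet y z)),
     (Join x y, Join y x), (Meet x y, Meet y x),
     (Join x (Meet x y), x), (Meet x (Join x y), x),
     (Meet x (Join y z), Join (Meet x y) (Meet x z)),
     (Join x Zero, x), (Meet x One, x), (Join x (Compl x), One), (Meet x (Compl x), Zero),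
     (Comp Ident x, x), (Comp x Ident, x),
     (Meet (Comp (Conv x) (Meet z (Compl (Comp x y)))) y, Zero),
     (Meet (Comp x (Meet y (Compl (Comp (Conv x) z)))) z, Zero),
     (Meet (Comp z (Conv (Meet y (Compl (Comp (Conv x) z))))) x, Zero),
     (Meet (Comp (Conv (Meet x (Compl (Comp z (Conv y))))) z) y, Zero)})"

definition SA_axioms :: "(trm \<times> trm) set" where
  "SA_axioms = insert (Comp (Comp (Var 0) One) One, Comp (Var 0) One) NA_axioms"

definition RSA_axioms :: "(trm \<times> trm) set" where
  "RSA_axioms = (let x = Var 0; y = Var 1 in
    {(Meet x (Comp x x), x),
     (Meet (Comp x (Meet (Compl x) y)) (Join x y), Comp x (Meet (Compl x) y)),
     (Conv x, x)}) \<union> SA_axioms"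

context boolean_reduct
begin

lemma closed [simp]:
  "\<zero> \<in> carrier A" "\<one> \<in> carrier A" "\<e> \<in> carrier A"
  "x \<in> carrier A \<Longrightarrow> \<sim> x \<in> carrier A" "x \<in> carrier A \<Longrightarrow> \<smile> x \<in> carrier A"
  "\<lbrakk>x \<in> carrier A; y \<in> carrier A\<rbrakk> \<Longrightarrow> x \<^bold>\<or> y \<in> carrier A"
  "\<lbrakk>x \<in> carrier A; y \<in> carrier A\<rbrakk> \<Longrightarrow> x \<^bold>\<and> y \<in> carrier A"
  "\<lbrakk>x \<in> carrier A; y \<in> carrier A\<rbrakk> \<Longrightarrow> x \<bullet> y \<in> carrier A"
  using algebra by (auto simp: algebra_def subuniverse_def)

lemma meet_zero: "x \<in> carrier A \<Longrightarrow> x \<^bold>\<and> \<zero> = \<zero>"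
  by (metis closed(1,4) join_comm join_zero meet_absorb meet_comm)

lemma meet_compl_meet:
  assumes "x \<in> carrier A" "y \<in> carrier A"
  shows "y \<^bold>\<and> (x \<^bold>\<and> \<sim> y) = \<zero>"
  using assms by (metis closed(4) meet_assoc meet_comm meet_compl meet_zero)

lemma meet_compl_of_disjoint:
  assumes "x \<in> carrier A" "y \<in> carrier A" "y \<^bold>\<and> x = \<zero>"
  shows "x \<^bold>\<and> \<sim> y = x"
proof -
  have "x = x \<^bold>\<and> (y \<^bold>\<or> \<sim> y)" using assms by (simp add: join_compl meet_one)
  also have "\<dots> = \<zero> \<^bold>\<or> (x \<^bold>\<and> \<sim> y)"
    using assms by (simp add: meet_join_distrib meet_comm[of x y])
  also have "\<dots> = x \<^bold>\<and> \<sim> y" using assms by (simp add: join_comm[of \<zero>] join_zero)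
  finally show ?thesis by simp
qed

end

lemma eval_axiom_instance:
  assumes "E \<subseteq> identities A" "x \<in> carrier A" "y \<in> carrier A" "z \<in> carrier A"
  shows "\<forall>(s, t)\<in>E. eval A (case_nat x (case_nat y (\<lambda>_. z))) s = eval A (case_nat x (case_nat y (\<lambda>_. z))) t"
proof -
  have "range (case_nat x (case_nat y (\<lambda>_. z))) \<subseteq> carrier A"
    using assms(2-) by (auto split: nat.splits)
  then show ?thesis using assms(1) identitiesD by blast
qed

lemma subset_identitiesI:
  assumes "\<And>\<rho>. range \<rho> \<subseteq> carrier A \<Longrightarrow> \<forall>(s, t)\<in>E. eval A \<rho> s = eval A \<rho> t"
  shows "E \<subseteq> identities A"
  using assms by (fastforce simp: identities_def satisfies_def)

lemma NA_axioms_hold: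
  assumes "NA_axioms \<subseteq> identities A" "x \<in> carrier A" "y \<in> carrier A" "z \<in> carrier A"
  shows "(x \<^bold>\<or>\<^bsub>A\<^esub> y) \<^bold>\<or>\<^bsub>A\<^esub> z = x \<^bold>\<or>\<^bsub>A\<^esub> (y \<^bold>\<or>\<^bsub>A\<^esub> z)"
    "(x \<^bold>\<and>\<^bsub>A\<^esub> y) \<^bold>\<and>\<^bsub>A\<^esub> z = x \<^bold>\<and>\<^bsub>A\<^esub> (y \<^bold>\<and>\<^bsub>A\<^esub> z)"
    "x \<^bold>\<or>\<^bsub>A\<^esub> y = y \<^bold>\<or>\<^bsub>A\<^esub> x" "x \<^bold>\<and>\<^bsub>A\<^esub> y = y \<^bold>\<and>\<^bsub>A\<^esub> x"
    "x \<^bold>\<or>\<^bsub>A\<^esub> (x \<^bold>\<and>\<^bsub>A\<^esub> y) = x" "x \<^bold>\<and>\<^bsub>A\<^esub> (x \<^bold>\<or>\<^bsub>A\<^esub> y) = x"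
    "x \<^bold>\<and>\<^bsub>A\<^esub> (y \<^bold>\<or>\<^bsub>A\<^esub> z) = (x \<^bold>\<and>\<^bsub>A\<^esub> y) \<^bold>\<or>\<^bsub>A\<^esub> (x \<^bold>\<and>\<^bsub>A\<^esub> z)"
    "x \<^bold>\<or>\<^bsub>A\<^esub> \<zero>\<^bsub>A\<^esub> = x" "x \<^bold>\<and>\<^bsub>A\<^esub> \<one>\<^bsub>A\<^esub> = x"
    "x \<^bold>\<or>\<^bsub>A\<^esub> \<sim>\<^bsub>A\<^esub> x = \<one>\<^bsub>A\<^esub>" "x \<^bold>\<and>\<^bsub>A\<^esub> \<sim>\<^bsub>A\<^esub> x = \<zero>\<^bsub>A\<^esub>"
    "\<e>\<^bsub>A\<^esub> \<bullet>\<^bsub>A\<^esub> x = x" "x \<bullet>\<^bsub>A\<^esub> \<e>\<^bsub>A\<^esub> = x"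
    "((\<smile>\<^bsub>A\<^esub> x) \<bullet>\<^bsub>A\<^esub> (z \<^bold>\<and>\<^bsub>A\<^esub> \<sim>\<^bsub>A\<^esub> (x \<bullet>\<^bsub>A\<^esub> y))) \<^bold>\<and>\<^bsub>A\<^esub> y = \<zero>\<^bsub>A\<^esub>"
    "(x \<bullet>\<^bsub>A\<^esub> (y \<^bold>\<and>\<^bsub>A\<^esub> \<sim>\<^bsub>A\<^esub> ((\<smile>\<^bsub>A\<^esub> x) \<bullet>\<^bsub>A\<^esub> z))) \<^bold>\<and>\<^bsub>A\<^esub> z = \<zero>\<^bsub>A\<^esub>"
    "(z \<bullet>\<^bsub>A\<^esub> (\<smile>\<^bsub>A\<^esub> (y \<^bold>\<and>\<^bsub>A\<^esub> \<sim>\<^bsub>A\<^esub> ((\<smile>\<^bsub>A\<^esub> x) \<bullet>\<^bsub>A\<^esub> z)))) \<^bold>\<and>\<^bsub>A\<^esub> x = \<zero>\<^bsub>A\<^esub>"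
    "((\<smile>\<^bsub>A\<^esub> (x \<^bold>\<and>\<^bsub>A\<^esub> \<sim>\<^bsub>A\<^esub> (z \<bullet>\<^bsub>A\<^esub> (\<smile>\<^bsub>A\<^esub> y)))) \<bullet>\<^bsub>A\<^esub> z) \<^bold>\<and>\<^bsub>A\<^esub> y = \<zero>\<^bsub>A\<^esub>"
  using eval_axiom_instance[OF assms]
  unfolding NA_axioms_def Let_def numeral_2_eq_2 One_nat_def ball_simps prod.case eval.simps nat.case
  by - (elim conjE, assumption)+

lemma nonassociative_relation_algebra_if_axioms:
  assumes "algebra A" "NA_axioms \<subseteq> identities A"
  shows "nonassociative_relation_algebra A"
proof -
  note ax = NA_axioms_hold[OF assms(2)]
  have zero: "\<zero>\<^bsub>A\<^esub> \<in> carrier A" using assms(1) by (auto simp: algebra_def subuniverse_def)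
  interpret boolean_reduct A
    by unfold_locales (rule assms(1) | assumption | rule ax zero)+
  show ?thesis
  proof
    fix x y z assume xyz [simp]: "x \<in> carrier A" "y \<in> carrier A" "z \<in> carrier A"
    show "\<e>\<^bsub>A\<^esub> \<bullet>\<^bsub>A\<^esub> x = x" "x \<bullet>\<^bsub>A\<^esub> \<e>\<^bsub>A\<^esub> = x"
      by (rule ax(12,13)[OF xyz(1) zero zero])+
    \<comment> \<open>An element disjoint from \<open>w\<close> equals its part outside
      \<open>w\<close>, so the equational forms give back the implications.\<close>
    show "(x \<bullet>\<^bsub>A\<^esub> y) \<^bold>\<and>\<^bsub>A\<^esub> z = \<zero>\<^bsub>A\<^esub> \<longleftrightarrow> ((\<smile>\<^bsub>A\<^esub> x) \<bullet>\<^bsub>A\<^esub> z) \<^bold>\<and>\<^bsub>A\<^esub> y = \<zero>\<^bsub>A\<^esub>"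
      using ax(14,15)[OF xyz] meet_compl_of_disjoint[of z "x \<bullet>\<^bsub>A\<^esub> y"]
        meet_compl_of_disjoint[of y "(\<smile>\<^bsub>A\<^esub> x) \<bullet>\<^bsub>A\<^esub> z"] by auto
    show "((\<smile>\<^bsub>A\<^esub> x) \<bullet>\<^bsub>A\<^esub> z) \<^bold>\<and>\<^bsub>A\<^esub> y = \<zero>\<^bsub>A\<^esub> \<longleftrightarrow> (z \<bullet>\<^bsub>A\<^esub> (\<smile>\<^bsub>A\<^esub> y)) \<^bold>\<and>\<^bsub>A\<^esub> x = \<zero>\<^bsub>A\<^esub>"
      using ax(16,17)[OF xyz] meet_compl_of_disjoint[of y "(\<smile>\<^bsub>A\<^esub> x) \<bullet>\<^bsub>A\<^esub> z"]
        meet_compl_of_disjoint[of x "z \<bullet>\<^bsub>A\<^esub> (\<smile>\<^bsub>A\<^esub> y)"] by auto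
  qed
qed

context nonassociative_relation_algebra
begin

lemma NA_axioms_satisfied: "NA_axioms \<subseteq> identities A"
proof -
  show ?thesis
  proof (rule subset_identitiesI)
    fix \<rho> :: "nat \<Rightarrow> 'a" assume that: "range \<rho> \<subseteq> carrier A"
    define x y z where "x = \<rho> 0" "y = \<rho> 1" "z = \<rho> 2"
    then have xyz: "x \<in> carrier A" "y \<in> carrier A" "z \<in> carrier A" using that by auto
    then have *: "\<smile> x \<in> carrier A" "\<smile> y \<in> carrier A" "x \<bullet> y \<in> carrier A"
      "\<smile> x \<bullet> z \<in> carrier A" "z \<bullet> \<smile> y \<in> carrier A" by simp_all
    have "(\<smile> x \<bullet> (z \<^bold>\<and> \<sim> (x \<bullet> y))) \<^bold>\<and> y = \<zero>"
      using meet_compl_meet[OF xyz(3) *(3)] triangle1[of x y "z \<^bold>\<and> \<sim> (x \<bullet> y)"] xyz by simp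
    moreover have "(x \<bullet> (y \<^bold>\<and> \<sim> (\<smile> x \<bullet> z))) \<^bold>\<and> z = \<zero>"
      using meet_compl_meet[OF xyz(2) *(4)] triangle1[of x "y \<^bold>\<and> \<sim> (\<smile> x \<bullet> z)" z] xyz by simp
    moreover have "(z \<bullet> \<smile> (y \<^bold>\<and> \<sim> (\<smile> x \<bullet> z))) \<^bold>\<and> x = \<zero>"
      using meet_compl_meet[OF xyz(2) *(4)] triangle2[of x "y \<^bold>\<and> \<sim> (\<smile> x \<bullet> z)" z] xyz by simp
    moreover have "(\<smile> (x \<^bold>\<and> \<sim> (z \<bullet> \<smile> y)) \<bullet> z) \<^bold>\<and> y = \<zero>"
      using meet_compl_meet[OF xyz(1) *(5)] triangle2[of "x \<^bold>\<and> \<sim> (z \<bullet> \<smile> y)" y z] xyz by simp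
    ultimately show "\<forall>(s, t)\<in>NA_axioms. eval A \<rho> s = eval A \<rho> t"
      unfolding NA_axioms_def Let_def ball_simps prod.case eval.simps x_y_z_def[symmetric]
      using xyz by (intro conjI join_assoc meet_assoc join_comm meet_comm join_absorb meet_absorb
        meet_join_distrib join_zero meet_one join_compl meet_compl id_comp comp_id TrueI)
  qed
qed

end

lemma NA_eq_models: "NA = models NA_axioms"
proof -
  have "nonassociative_relation_algebra A \<longleftrightarrow> A \<in> models NA_axioms" for A :: "'a ra"
    using nonassociative_relation_algebra_if_axioms[of A]
      nonassociative_relation_algebra.NA_axioms_satisfied[of A]
      boolean_reduct.algebra[OF nonassociative_relation_algebra.axioms(1), of A]
    by (auto simp: in_models_iff)
  then show ?thesis by (auto simp: NA_def)
qed

lemma SA_eq_models: "SA = models SA_axioms"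
proof -
  have "semiassociative_relation_algebra A \<longleftrightarrow> A \<in> models SA_axioms" for A :: "'a ra"
  proof
    assume "semiassociative_relation_algebra A"
    then interpret semiassociative_relation_algebra A .
    have "(Comp (Comp (Var 0) One) One, Comp (Var 0) One) \<in> identities A"
      by (rule identitiesI) (auto intro: semiassociative)
    then show "A \<in> models SA_axioms"
      using NA_axioms_satisfied algebra by (simp add: in_models_iff SA_axioms_def)
  next
    assume "A \<in> models SA_axioms"
    then have A: "algebra A" and E: "SA_axioms \<subseteq> identities A" by (auto simp: in_models_iff)
    then interpret nonassociative_relation_algebra A
      by (intro nonassociative_relation_algebra_if_axioms) (auto simp: SA_axioms_def)
    show "semiassociative_relation_algebra A"
    proof
      fix x assume "x \<in> carrier A"
      then show "(x \<bullet>\<^bsub>A\<^esub> \<one>\<^bsub>A\<^esub>) \<bullet>\<^bsub>A\<^esub> \<one>\<^bsub>A\<^esub> = x \<bullet>\<^bsub>A\<^esub> \<one>\<^bsub>A\<^esub>"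
        using eval_axiom_instance[OF E, of x x x] by (simp add: SA_axioms_def)
    qed
  qed
  then show ?thesis by (auto simp: SA_def)
qed

lemma RSA_eq_models: "RSA = models RSA_axioms"
proof -
  have "reflexive_subadditive_symmetric_semiassociative_relation_algebra A \<longleftrightarrow> A \<in> models RSA_axioms"
    for A :: "'a ra"
  proof
    assume "reflexive_subadditive_symmetric_semiassociative_relation_algebra A"
    then interpret reflexive_subadditive_symmetric_semiassociative_relation_algebra A .
    have "semiassociative_relation_algebra A" by unfold_locales
    then have "A \<in> models SA_axioms" by (simp add: SA_eq_models[symmetric] SA_def)
    moreover have "RSA_axioms - SA_axioms \<subseteq> identities A"
    proof (rule subset_identitiesI)
      fix \<rho> :: "nat \<Rightarrow> 'a" assume "range \<rho> \<subseteq> carrier A"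
      then have "\<rho> 0 \<in> carrier A" "\<rho> 1 \<in> carrier A" by auto
      then show "\<forall>(s, t)\<in>RSA_axioms - SA_axioms. eval A \<rho> s = eval A \<rho> t"
        using reflexive[of "\<rho> 0"] subadditive[of "\<rho> 0" "\<rho> 1"] symmetric[of "\<rho> 0"]
        by (auto simp: RSA_axioms_def Let_def ra_le_def)
    qed
    ultimately show "A \<in> models RSA_axioms"
      unfolding in_models_iff by blast
  next
    assume "A \<in> models RSA_axioms"
    then have A: "algebra A" and E: "RSA_axioms \<subseteq> identities A" by (auto simp: in_models_iff)
    then have "A \<in> SA" by (auto simp: SA_eq_models in_models_iff RSA_axioms_def Let_def)
    then interpret semiassociative_relation_algebra A by (simp add: SA_def)
    show "reflexive_subadditive_symmetric_semiassociative_relation_algebra A"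
    proof
      fix x y assume "x \<in> carrier A" "y \<in> carrier A"
      then show "x \<preceq>\<^bsub>A\<^esub> x \<bullet>\<^bsub>A\<^esub> x" "x \<bullet>\<^bsub>A\<^esub> ((\<sim>\<^bsub>A\<^esub> x) \<^bold>\<and>\<^bsub>A\<^esub> y) \<preceq>\<^bsub>A\<^esub> x \<^bold>\<or>\<^bsub>A\<^esub> y" "\<smile>\<^bsub>A\<^esub> x = x"
        using eval_axiom_instance[OF E, of x y y]
        by (simp_all add: RSA_axioms_def Let_def ra_le_def)
    qed
  qed
  then show ?thesis by (auto simp: RSA_def)
qed

section \<open>Lattices of subvarieties\<close>

text \<open>
  \<^const>\<open>join\<close> and \<^const>\<open>bottom\<close> of a \<^typ>\<open>'a gorder\<close> are picked by an epsilon operator, so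
  the existence of least upper bounds has to be shown; it needs \<^term>\<open>K\<close> to be a variety.
\<close>

lemma Upper_subvariety_lattice:
  assumes "X \<subseteq> carrier (subvariety_lattice K)"
  shows "Upper (subvariety_lattice K) X = {u. variety u \<and> u \<subseteq> K \<and> (\<forall>c\<in>X. c \<subseteq> u)}"
  using assms by (fastforce simp: subvariety_lattice_def Upper_def)

text \<open>Every variety containing the members of \<open>X\<close> is defined by some of their
  common identities, and fewer identities have more models.\<close>

lemma least_variety_above:
  assumes "K = models E" "X \<subseteq> carrier (subvariety_lattice K)"
  defines "V \<equiv> models (\<Inter>A\<in>\<Union>X. identities A)"
  shows "least (subvariety_lattice K) V (Upper (subvariety_lattice K) X)"
proof -
  have "E \<subseteq> (\<Inter>A\<in>\<Union>X. identities A)"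
    using assms(1,2) by (fastforce simp: subvariety_lattice_def in_models_iff)
  then have "V \<subseteq> K" unfolding assms(1) V_def by (rule models_antimono)
  moreover have "\<Union>X \<subseteq> V"
  proof
    fix A assume "A \<in> \<Union>X"
    moreover from this have "algebra A"
      using assms(2) by (auto simp: subvariety_lattice_def variety_def in_models_iff)
    ultimately show "A \<in> V" by (auto simp: V_def in_models_iff)
  qed
  moreover have "V \<subseteq> V'" if "variety V'" "\<Union>X \<subseteq> V'" for V'
  proof -
    from that(1) obtain E' where V': "V' = models E'" by (auto simp: variety_def)
    with that(2) have "E' \<subseteq> (\<Inter>A\<in>\<Union>X. identities A)"
      by (intro INT_greatest) (blast dest: in_models_iff[THEN iffD1])
    then show ?thesis unfolding V' V_def by (rule models_antimono)
  qed
  moreover have "variety V" by (auto simp: variety_def V_def)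
  ultimately have V: "variety V" "V \<subseteq> K" "\<And>c. c \<in> X \<Longrightarrow> c \<subseteq> V"
    "\<And>V'. \<lbrakk>variety V'; \<forall>c\<in>X. c \<subseteq> V'\<rbrakk> \<Longrightarrow> V \<subseteq> V'"
    by (simp_all add: Sup_le_iff)
  have "{u. variety u \<and> u \<subseteq> K \<and> (\<forall>c\<in>X. c \<subseteq> u)} \<subseteq> carrier (subvariety_lattice K)"
    by (auto simp: subvariety_lattice_def)
  with V show ?thesis
    unfolding least_def Upper_subvariety_lattice[OF assms(2)]
    by (simp add: subvariety_lattice_def)
qed

text \<open>Since all proper subvarieties of \<open>V\<close> lie below \<open>W\<close>, none is
  strictly between \<open>W\<close> and \<open>V\<close>, and the join of two of them is still below
  \<open>W\<close>, hence not \<open>V\<close>.\<close>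

lemma join_irreducible_coverI:
  assumes K: "K = models E" and W: "variety W" and V: "variety V" "V \<subseteq> K" and "W \<subset> V"
    and min: "\<And>c. \<lbrakk>variety c; c \<subset> V\<rbrakk> \<Longrightarrow> c \<subseteq> W"
  shows "V \<in> join_irreducible_covers (subvariety_lattice K) W"
proof -
  let ?L = "subvariety_lattice K"
  have L: "carrier ?L = {V. variety V \<and> V \<subseteq> K}" "x \<sqsubseteq>\<^bsub>?L\<^esub> y \<longleftrightarrow> x \<subseteq> y"
    "x \<sqsubset>\<^bsub>?L\<^esub> y \<longleftrightarrow> x \<subset> y" for x y
    by (auto simp: subvariety_lattice_def lless_def)
  have WK: "W \<subseteq> K" by (rule order.trans[OF psubset_imp_subset[OF \<open>W \<subset> V\<close>] V(2)])
  have "covers ?L V W"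
  proof -
    have "\<not> (W \<subset> c \<and> c \<subset> V)" if "variety c" for c
    proof
      assume *: "W \<subset> c \<and> c \<subset> V"
      then have "c \<subseteq> W" using min[OF that] by simp
      with * show False by (simp add: subset_not_subset_eq)
    qed
    then show ?thesis unfolding covers_def L mem_Collect_eq using W WK V \<open>W \<subset> V\<close> by blast
  qed
  moreover have "join_irreducible ?L V"
  proof -
    \<comment> \<open>For the empty set of varieties every element of the lattice is an upper bound,
      so the least upper bound is the bottom.\<close>
    have "least ?L (\<bottom>\<^bsub>?L\<^esub>) (carrier ?L)"
      using least_variety_above[OF K, of "{}"] unfolding bottom_def by (intro someI) (simp add: Upper_def)
    then have "\<bottom>\<^bsub>?L\<^esub> \<subseteq> W" using W WK by (simp add: least_def L)
    moreover have "V = c \<or> V = d" if cd: "c \<in> carrier ?L" "d \<in> carrier ?L" "V = c \<squnion>\<^bsub>?L\<^esub> d" for c d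
    proof (rule ccontr)
      assume *: "\<not> (V = c \<or> V = d)"
      have "least ?L V (Upper ?L {c, d})"
        using least_variety_above[OF K, of "{c, d}"] cd(1,2) unfolding cd(3) join_def sup_def
        by (intro someI) simp
      moreover have "{c, d} \<subseteq> carrier ?L" using cd by simp
      ultimately have V_le: "c \<subseteq> V" "d \<subseteq> V" "\<And>u. \<lbrakk>variety u; u \<subseteq> K; c \<subseteq> u; d \<subseteq> u\<rbrakk> \<Longrightarrow> V \<subseteq> u"
        by (simp_all add: least_def Upper_subvariety_lattice L)
      have "variety c" "variety d" using cd(1,2) by (simp_all add: L)
      moreover have "c \<subset> V" "d \<subset> V" using V_le(1,2) * by auto
      ultimately have "c \<subseteq> W" "d \<subseteq> W" by (simp_all add: min)
      then have "V \<subseteq> W" using V_le(3)[OF W WK] by simp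
      with \<open>W \<subset> V\<close> show False by simp
    qed
    ultimately show ?thesis
      unfolding join_irreducible_def using V \<open>W \<subset> V\<close> by (simp add: L)
  qed
  ultimately show ?thesis by (simp add: join_irreducible_covers_def)
qed

text \<open>There are countably many pairs of terms, so a set of equations can be coded as a set of
  natural numbers.\<close>

lemma varieties_lepoll: "{V :: 'a ra set. variety V} \<lesssim> (UNIV :: nat set set)"
proof -
  have "{V :: 'a ra set. variety V} \<subseteq> (\<lambda>X. models (from_nat ` X)) ` (UNIV :: nat set set)"
  proof clarify
    fix V :: "'a ra set" assume "variety V"
    then obtain E where "V = models E" by (auto simp: variety_def)
    then have "V = models (from_nat ` to_nat ` E)" by (simp add: image_image)
    then show "V \<in> range (\<lambda>X. models (from_nat ` X))" by blast
  qed
  then show ?thesis using subset_imp_lepoll image_lepoll lepoll_trans by metis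
qed

section \<open>The four-element algebra\<close>

text \<open>The pair \<open>(a, b)\<close> stands for the join of \<open>e\<close> (if \<open>a\<close>) and \<open>e'\<close> (if \<open>b\<close>).\<close>

definition four :: "(bool \<times> bool) ra" where
  "four = \<lparr>carrier = UNIV,
     ra_join = (\<lambda>(a, b) (c, d). (a \<or> c, b \<or> d)), ra_meet = (\<lambda>(a, b) (c, d). (a \<and> c, b \<and> d)),
     ra_comp = (\<lambda>(a, b) (c, d). (a \<and> c \<or> b \<and> d, a \<and> d \<or> b \<and> c \<or> b \<and> d)),
     ra_compl = (\<lambda>(a, b). (\<not> a, \<not> b)), ra_conv = (\<lambda>x. x),
     ra_zero = (False, False), ra_one = (True, True), ra_id = (True, False)\<rparr>"

lemma algebra_four: "algebra four"
  by (simp add: algebra_def subuniverse_def four_def)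

lemma three_elements_avoiding:
  assumes "card U = 3"
  shows "\<exists>z\<in>U. z \<noteq> x \<and> z \<noteq> y"
proof -
  have "\<not> U \<subseteq> {x, y}" using assms card_mono[of "{x, y}" U] card_insert_le_m1[of 2 "{y}" x] by auto
  then show ?thesis by blast
qed

text \<open>On three points any two, equal or not, have a third one different from both, so the
  diversity relation \<open>d\<close> satisfies \<open>d O d = U \<times> U\<close>. Hence the empty
  relation, the identity, \<open>d\<close> and \<open>U \<times> U\<close> are closed under all
  operations, and every subuniverse contains them.\<close>

lemma minimal_relation_algebra_identities:
  fixes U :: "'u set"
  assumes U: "card U = 3"
  shows "algebra (minimal_relation_algebra U)"
    and "identities (minimal_relation_algebra U) = identities four"
proof -
  define A where "A = full_relation_algebra U"
  define d where "d = U \<times> U - Id_on U"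
  define h where "h = (\<lambda>(a, b). (if a then Id_on U else {}) \<union> (if b then d else {}))"
  have dd: "d O d = U \<times> U"
  proof
    show "U \<times> U \<subseteq> d O d"
    proof clarify
      fix x y assume "x \<in> U" "y \<in> U"
      moreover obtain z where "z \<in> U" "z \<noteq> x" "z \<noteq> y"
        using three_elements_avoiding[OF U] by blast
      ultimately have "(x, z) \<in> d" "(z, y) \<in> d" by (auto simp: d_def)
      then show "(x, y) \<in> d O d" by blast
    qed
  qed (auto simp: d_def)
  have one: "Id_on U \<union> d = U \<times> U" "d \<union> Id_on U = U \<times> U" "Id_on U \<inter> d = {}" "d \<inter> Id_on U = {}"
    "U \<times> U - Id_on U = d" "U \<times> U - d = Id_on U" "d - U \<times> U = {}"
    "Id_on U O d = d" "d O Id_on U = d" "Id_on U O Id_on U = Id_on U"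
    "d\<inverse> = d" "(Id_on U)\<inverse> = Id_on U" "(U \<times> U)\<inverse> = U \<times> U"
    by (auto simp: d_def)
  have oo: "U \<times> U O U \<times> U = U \<times> U" "d O U \<times> U = U \<times> U" "U \<times> U O d = U \<times> U"
    "Id_on U O U \<times> U = U \<times> U" "U \<times> U O Id_on U = U \<times> U"
  proof -
    have "\<exists>z. (x, z) \<in> d \<and> (z, x) \<in> d" if "x \<in> U" for x
      using three_elements_avoiding[OF U, of x x] that by (auto simp: d_def)
    moreover have "d \<subseteq> U \<times> U" by (auto simp: d_def)
    ultimately show "d O U \<times> U = U \<times> U" "U \<times> U O d = U \<times> U" by blast+
  qed blast+
  have le: "Id_on U \<subseteq> U \<times> U" "d \<subseteq> U \<times> U" by (auto simp: d_def)
  obtain u v where "u \<in> U" "v \<in> U" "u \<noteq> v"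
    using three_elements_avoiding[OF U] by blast
  then have ne: "(u, u) \<in> Id_on U" "(u, u) \<notin> d" "(u, v) \<notin> Id_on U" "(u, v) \<in> d"
    by (auto simp: d_def)
  have h: "h (False, False) = {}" "h (True, True) = U \<times> U" "h (True, False) = Id_on U"
    "h (False, True) = d"
    by (auto simp: h_def one)
  have hom: "h (x \<^bold>\<or>\<^bsub>four\<^esub> y) = h x \<^bold>\<or>\<^bsub>A\<^esub> h y" "h (x \<^bold>\<and>\<^bsub>four\<^esub> y) = h x \<^bold>\<and>\<^bsub>A\<^esub> h y"
    "h (x \<bullet>\<^bsub>four\<^esub> y) = h x \<bullet>\<^bsub>A\<^esub> h y" "h (\<sim>\<^bsub>four\<^esub> x) = \<sim>\<^bsub>A\<^esub> h x" "h (\<smile>\<^bsub>four\<^esub> x) = \<smile>\<^bsub>A\<^esub> h x"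
    "h \<zero>\<^bsub>four\<^esub> = \<zero>\<^bsub>A\<^esub>" "h \<one>\<^bsub>four\<^esub> = \<one>\<^bsub>A\<^esub>" "h \<e>\<^bsub>four\<^esub> = \<e>\<^bsub>A\<^esub>" for x y
  proof -
    obtain a b c e where [simp]: "x = (a, b)" "y = (c, e)" by (metis surj_pair)
    note abs = Un_absorb1[OF le(1)] Un_absorb1[OF le(2)] Un_absorb2[OF le(1)] Un_absorb2[OF le(2)]
      Int_absorb1[OF le(1)] Int_absorb1[OF le(2)] Int_absorb2[OF le(1)] Int_absorb2[OF le(2)]
    note defs = four_def A_def full_relation_algebra_def h abs one dd oo
    show "h (x \<^bold>\<or>\<^bsub>four\<^esub> y) = h x \<^bold>\<or>\<^bsub>A\<^esub> h y"
      by (cases a; cases b; cases c; cases e; simp add: defs)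
    show "h (x \<^bold>\<and>\<^bsub>four\<^esub> y) = h x \<^bold>\<and>\<^bsub>A\<^esub> h y"
      by (cases a; cases b; cases c; cases e; simp add: defs)
    show "h (x \<bullet>\<^bsub>four\<^esub> y) = h x \<bullet>\<^bsub>A\<^esub> h y"
      by (cases a; cases b; cases c; cases e; simp add: defs)
    show "h (\<sim>\<^bsub>four\<^esub> x) = \<sim>\<^bsub>A\<^esub> h x" by (cases a; cases b; simp add: defs)
    show "h (\<smile>\<^bsub>four\<^esub> x) = \<smile>\<^bsub>A\<^esub> h x" by (cases a; cases b; simp add: defs)
  qed (simp_all add: four_def A_def full_relation_algebra_def h)
  have sub: "subuniverse A (range h)"
  proof -
    have "h x \<in> carrier A" for x by (auto simp: h_def A_def full_relation_algebra_def d_def split: prod.splits)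
    then show ?thesis
      unfolding subuniverse_def
      by (simp add: image_subset_iff hom(1-5)[symmetric] flip: hom(6-8))
  qed
  moreover have "range h \<subseteq> S" if "subuniverse A S" for S
  proof -
    from that have "\<zero>\<^bsub>A\<^esub> \<in> S" "\<one>\<^bsub>A\<^esub> \<in> S" "\<e>\<^bsub>A\<^esub> \<in> S" "\<sim>\<^bsub>A\<^esub> \<e>\<^bsub>A\<^esub> \<in> S" by (auto simp: subuniverse_def)
    then have "{} \<in> S" "U \<times> U \<in> S" "Id_on U \<in> S" "d \<in> S"
      by (auto simp: A_def full_relation_algebra_def one)
    then show ?thesis by (auto simp: h_def one)
  qed
  ultimately have "\<Inter>{S. subuniverse A S \<and> {} \<subseteq> S} = range h" by blast
  then have M: "minimal_relation_algebra U = A\<lparr>carrier := range h\<rparr>"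
    by (simp add: minimal_relation_algebra_def generated_subalgebra_def A_def)
  with sub show "algebra (minimal_relation_algebra U)" by (simp add: algebra_def subuniverse_def)
  have "ra_hom four (A\<lparr>carrier := range h\<rparr>) h" by (simp add: ra_hom_def hom)
  moreover have "inj h"
  proof (rule injI)
    fix x y assume "h x = h y"
    then show "x = y" using ne by (cases x; cases y) (auto simp: h_def split: if_splits)
  qed
  ultimately show "identities (minimal_relation_algebra U) = identities four"
    unfolding M using identities_of_embedded[of four _ h] identities_of_image[of four _ h] algebra_four
    by (intro subset_antisym) (auto simp: four_def)
qed

section \<open>Complex algebras of total graphs\<close>

text \<open>
  The atoms are the identity \<^const>\<open>None\<close> and the vertices of a reflexive graph \<open>R\<close>. A cycle
  of three vertices has at most two distinct members, and \<open>x, x, z\<close> is a cycle iff \<open>R x z\<close>; this makes the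
  algebra subadditive.
\<close>

fun cycle :: "('v \<Rightarrow> 'v \<Rightarrow> bool) \<Rightarrow> 'v option \<Rightarrow> 'v option \<Rightarrow> 'v option \<Rightarrow> bool" where
  "cycle R None b c \<longleftrightarrow> b = c"
| "cycle R (Some x) None c \<longleftrightarrow> c = Some x"
| "cycle R (Some x) (Some y) None \<longleftrightarrow> x = y"
| "cycle R (Some x) (Some y) (Some z) \<longleftrightarrow> x = y \<and> R x z \<or> x = z \<and> R x y \<or> y = z \<and> R y x"

definition complex_algebra :: "('v \<Rightarrow> 'v \<Rightarrow> bool) \<Rightarrow> 'v option set ra" where
  "complex_algebra R =
     \<lparr>carrier = UNIV, ra_join = (\<union>), ra_meet = (\<inter>),
      ra_comp = (\<lambda>X Y. {c. \<exists>a\<in>X. \<exists>b\<in>Y. cycle R a b c}),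
      ra_compl = uminus, ra_conv = (\<lambda>X. X),
      ra_zero = {}, ra_one = UNIV, ra_id = {None}\<rparr>"

lemma complex_algebra_simps [simp]:
  "carrier (complex_algebra R) = UNIV" "X \<^bold>\<or>\<^bsub>complex_algebra R\<^esub> Y = X \<union> Y"
  "X \<^bold>\<and>\<^bsub>complex_algebra R\<^esub> Y = X \<inter> Y" "\<sim>\<^bsub>complex_algebra R\<^esub> X = - X" "\<smile>\<^bsub>complex_algebra R\<^esub> X = X"
  "\<zero>\<^bsub>complex_algebra R\<^esub> = {}" "\<one>\<^bsub>complex_algebra R\<^esub> = UNIV" "\<e>\<^bsub>complex_algebra R\<^esub> = {None}"
  by (simp_all add: complex_algebra_def)

lemma complex_algebra_comp:
  "X \<bullet>\<^bsub>complex_algebra R\<^esub> Y = {c. \<exists>a\<in>X. \<exists>b\<in>Y. cycle R a b c}"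
  by (simp add: complex_algebra_def)

text \<open>Together with \<open>cycle_swap\<close> this makes the set of cycles invariant under all
  permutations, which yields the triangle laws for the trivial converse.\<close>

lemma cycle_rotate: "cycle R a b c \<longleftrightarrow> cycle R a c b"
  by (cases a; cases b; cases c) auto

lemma cycle_swap: "cycle R a b c \<longleftrightarrow> cycle R b a c"
  by (cases a; cases b; cases c) auto

lemma cycle_subadditive: "cycle R a b c \<Longrightarrow> a \<noteq> b \<Longrightarrow> c = a \<or> c = b"
  by (cases a; cases b; cases c) auto

locale total_graph =
  fixes R :: "'v \<Rightarrow> 'v \<Rightarrow> bool"
  assumes total: "R x y \<or> R y x"
begin

lemma cycle_total: "\<exists>b. cycle R a b c"
proof (cases a; cases c)
  fix x z assume "a = Some x" "c = Some z"
  then show ?thesis using total[of x z] by (metis cycle.simps(4))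
next
  fix x assume "a = Some x" "c = None"
  then show ?thesis by (metis cycle.simps(3))
qed (metis cycle.simps(1,2))+

lemma comp_one:
  "X \<bullet>\<^bsub>complex_algebra R\<^esub> UNIV = (if X = {} then {} else UNIV)"
  "UNIV \<bullet>\<^bsub>complex_algebra R\<^esub> X = (if X = {} then {} else UNIV)"
  unfolding complex_algebra_comp using cycle_total cycle_swap by auto blast+

lemma complex_algebra_RSA: "complex_algebra R \<in> RSA"
proof -
  have r: "R x x" for x using total by blast
  have "reflexive_subadditive_symmetric_semiassociative_relation_algebra (complex_algebra R)"
  proof (unfold_locales, goal_cases)
    case 1
    show ?case by (simp add: algebra_def subuniverse_def)
  next
    \<comment> \<open>Cases 13 to 19 are the two identity laws, the two triangle laws,
      semiassociativity, reflexivity and subadditivity. The Boolean laws and symmetry are left to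
      the end.\<close>
    case (13 x)
    then show ?case by (simp add: complex_algebra_comp)
  next
    case (14 x)
    then show ?case by (auto simp: complex_algebra_comp cycle_swap[of R _ None])
  next
    case (15 x y z)
    show ?case by (auto simp: complex_algebra_comp disjoint_iff) (metis cycle_rotate)+
  next
    case (16 x y z)
    show ?case by (auto simp: complex_algebra_comp disjoint_iff) (metis cycle_rotate cycle_swap)+
  next
    case (17 x)
    then show ?case by (simp add: comp_one)
  next
    case (18 x)
    have "cycle R a a a" for a using r by (cases a) auto
    then show ?case by (auto simp: ra_le_def complex_algebra_comp)
  next
    case (19 x y)
    then show ?case by (auto simp: ra_le_def complex_algebra_comp dest: cycle_subadditive)
  qed auto
  then show ?thesis by (simp add: RSA_def)
qed

end

section \<open>The operators \<open>dominated\<close> and \<open>dominating\<close> as term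
  functions\<close>

definition dominated :: "('v \<Rightarrow> 'v \<Rightarrow> bool) \<Rightarrow> 'v set \<Rightarrow> 'v set" where
  "dominated R B = {z. \<forall>x\<in>B. \<not> R x z}"

definition dominating :: "('v \<Rightarrow> 'v \<Rightarrow> bool) \<Rightarrow> 'v set \<Rightarrow> 'v set" where
  "dominating R B = {z. \<forall>x\<in>B. \<not> R z x}"

lemma dominated_empty [simp]: "dominated R {} = UNIV"
  by (simp add: dominated_def)

text \<open>The square of the vertex part of \<open>t\<close> contains exactly the vertices
  \<open>z\<close> with \<open>R x z\<close> for some vertex \<open>x\<close> in \<open>t\<close>: a
  cycle of distinct \<open>a\<close>, \<open>b\<close> adds only \<open>a\<close> or
  \<open>b\<close>, which are there by reflexivity.\<close>

definition dominated_term :: "trm \<Rightarrow> trm" where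
  "dominated_term t = Meet (Compl Ident) (Compl (Comp (Meet t (Compl Ident)) (Meet t (Compl Ident))))"

text \<open>If \<open>x\<close> is a vertex in \<open>t\<close> and \<open>y\<close>,
  \<open>z\<close> are vertices outside \<open>t\<close>, then a cycle \<open>x, y, z\<close> forces
  \<open>y = z\<close> and \<open>R z x\<close>. This reverses the direction of the edge.\<close>

definition dominating_term :: "trm \<Rightarrow> trm" where
  "dominating_term t = Meet (Meet (Compl Ident) (Compl t))
     (Compl (Comp (Meet t (Compl Ident)) (Meet (Compl Ident) (Compl t))))"

definition verts :: "'v option set \<Rightarrow> 'v set" where
  "verts X = Some -` X"

lemma verts_simps [simp]:
  "verts {} = {}" "verts UNIV = UNIV" "verts (- X) = - verts X" "verts (Some ` B) = B"
  "verts (X \<union> Y) = verts X \<union> verts Y" "verts (X \<inter> Y) = verts X \<inter> verts Y" "verts {None} = {}"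
  by (auto simp: verts_def)

lemma mem_verts: "x \<in> verts X \<longleftrightarrow> Some x \<in> X"
  by (simp add: verts_def)

context total_graph
begin

lemma refl: "R x x"
  using total by blast

lemma eval_dominated_term:
  "eval (complex_algebra R) \<rho> (dominated_term t) = Some ` dominated R (verts (eval (complex_algebra R) \<rho> t))"
proof (rule Set.set_eqI)
  fix c
  let ?X = "eval (complex_algebra R) \<rho> t"
  have "(\<exists>a\<in>?X \<inter> - {None}. \<exists>b\<in>?X \<inter> - {None}. cycle R a b (Some z)) \<longleftrightarrow> (\<exists>x\<in>verts ?X. R x z)" for z
  proof
    assume "\<exists>a\<in>?X \<inter> - {None}. \<exists>b\<in>?X \<inter> - {None}. cycle R a b (Some z)"
    then obtain a b where "a \<in> ?X" "a \<noteq> None" "b \<in> ?X" "b \<noteq> None" "cycle R a b (Some z)" by blast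
    then obtain x y where "Some x \<in> ?X" "Some y \<in> ?X" "cycle R (Some x) (Some y) (Some z)" by auto
    then show "\<exists>x\<in>verts ?X. R x z" using refl by (auto simp: Bex_def mem_verts)
  next
    assume "\<exists>x\<in>verts ?X. R x z"
    then obtain x where "Some x \<in> ?X" "R x z" by (auto simp: mem_verts)
    then show "\<exists>a\<in>?X \<inter> - {None}. \<exists>b\<in>?X \<inter> - {None}. cycle R a b (Some z)"
      by (intro bexI[of _ "Some x"]) auto
  qed
  then show "c \<in> eval (complex_algebra R) \<rho> (dominated_term t)
      \<longleftrightarrow> c \<in> Some ` dominated R (verts ?X)"
    by (cases c) (auto simp: dominated_term_def complex_algebra_comp dominated_def image_iff)
qed

lemma eval_dominating_term:
  "eval (complex_algebra R) \<rho> (dominating_term t) = Some ` dominating R (verts (eval (complex_algebra R) \<rho> t))"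
proof (rule Set.set_eqI)
  fix c
  let ?X = "eval (complex_algebra R) \<rho> t"
  have "(\<exists>a\<in>?X \<inter> - {None}. \<exists>b\<in>- {None} \<inter> - ?X. cycle R a b (Some z)) \<longleftrightarrow> (\<exists>x\<in>verts ?X. R z x)"
    if "Some z \<notin> ?X" for z
  proof
    assume "\<exists>a\<in>?X \<inter> - {None}. \<exists>b\<in>- {None} \<inter> - ?X. cycle R a b (Some z)"
    then obtain a b where "a \<in> ?X" "a \<noteq> None" "b \<notin> ?X" "b \<noteq> None" "cycle R a b (Some z)" by blast
    then obtain x y where "Some x \<in> ?X" "Some y \<notin> ?X" "cycle R (Some x) (Some y) (Some z)" by auto
    then show "\<exists>x\<in>verts ?X. R z x" using that by (auto simp: Bex_def mem_verts)
  next
    assume "\<exists>x\<in>verts ?X. R z x"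
    then obtain x where "Some x \<in> ?X" "R z x" by (auto simp: mem_verts)
    then show "\<exists>a\<in>?X \<inter> - {None}. \<exists>b\<in>- {None} \<inter> - ?X. cycle R a b (Some z)"
      using that by (intro bexI[of _ "Some x"] bexI[of _ "Some z"]) auto
  qed
  \<comment> \<open>By reflexivity no vertex in \<open>t\<close> dominates \<open>t\<close>, so the
    restriction to the complement of \<open>t\<close> loses nothing.\<close>
  moreover have "Some z \<notin> ?X" if "\<forall>x\<in>verts ?X. \<not> R z x" for z
    using that refl by (metis mem_verts)
  ultimately show "c \<in> eval (complex_algebra R) \<rho> (dominating_term t)
      \<longleftrightarrow> c \<in> Some ` dominating R (verts ?X)"
    by (cases c) (auto simp: dominating_term_def complex_algebra_comp dominating_def image_iff)
qed

text \<open>An automorphism of the graph permutes the atoms and preserves cycles. It thus induces an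
  automorphism of the algebra, and term functions commute with it.\<close>

lemma eval_translate:
  assumes "bij f" "\<And>x y. R (f x) (f y) \<longleftrightarrow> R x y"
  shows "eval (complex_algebra R) (\<lambda>n. map_option f ` \<rho> n) t = map_option f ` eval (complex_algebra R) \<rho> t"
proof (rule eval_hom)
  have bij: "bij (map_option f)"
  proof (rule bijI)
    show "inj (map_option f)" using assms(1) by (simp add: bij_is_inj option.inj_map)
    show "surj (map_option f)"
      unfolding surj_def using assms(1) by (metis bij_pointE option.exhaust_sel option.simps(8,9))
  qed
  have cyc: "cycle R (map_option f a) (map_option f b) (map_option f c) \<longleftrightarrow> cycle R a b c" for a b c
    using assms(2) bij_is_inj[OF assms(1)] by (cases a; cases b; cases c) (auto simp: inj_eq)
  have "map_option f ` (X \<bullet>\<^bsub>complex_algebra R\<^esub> Y)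
      = (map_option f ` X) \<bullet>\<^bsub>complex_algebra R\<^esub> (map_option f ` Y)" for X Y
  proof (rule Set.set_eqI)
    fix c
    obtain c' where c: "c = map_option f c'" using bij by (metis bij_pointE)
    show "c \<in> map_option f ` (X \<bullet>\<^bsub>complex_algebra R\<^esub> Y)
      \<longleftrightarrow> c \<in> (map_option f ` X) \<bullet>\<^bsub>complex_algebra R\<^esub> (map_option f ` Y)"
      unfolding c inj_image_mem_iff[OF bij_is_inj[OF bij]] by (simp add: complex_algebra_comp cyc)
  qed
  then show "ra_hom (complex_algebra R) (complex_algebra R) ((`) (map_option f))"
    using bij by (simp add: ra_hom_def image_Un image_Int bij_is_inj bij_image_Compl_eq bij_is_surj)
  show "algebra (complex_algebra R)" by (simp add: algebra_def subuniverse_def)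
qed simp

end

section \<open>A family of translation-invariant graphs on the real line\<close>

definition gap :: "real \<Rightarrow> real \<Rightarrow> real \<Rightarrow> bool" where
  "gap \<theta> x y \<longleftrightarrow> 0 < y - x \<and> y - x < \<theta> \<or> 1 \<le> y - x"

definition edge :: "real \<Rightarrow> real \<Rightarrow> real \<Rightarrow> bool" where
  "edge \<theta> x y \<longleftrightarrow> \<not> gap \<theta> x y"

locale real_frame =
  fixes \<theta> :: real
  assumes pos: "0 < \<theta>" and less_half: "\<theta> < 1 / 2"
begin

text \<open>A gap leads from a smaller number to a larger one, so at most one of the two directions
  lacks an edge.\<close>

sublocale total_graph "edge \<theta>"
  by unfold_locales (auto simp: edge_def gap_def)

abbreviation "CA \<equiv> complex_algebra (edge \<theta>)"
abbreviation "F \<equiv> dominated (edge \<theta>)"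
abbreviation "G \<equiv> dominating (edge \<theta>)"

lemma mem_F: "z \<in> F A \<longleftrightarrow> (\<forall>x\<in>A. gap \<theta> x z)"
  by (simp add: dominated_def edge_def)

lemma mem_G: "z \<in> G A \<longleftrightarrow> (\<forall>x\<in>A. gap \<theta> z x)"
  by (simp add: dominating_def edge_def)

lemma F_UNIV: "F UNIV = {}"
  unfolding set_eq_iff mem_F by (auto simp: gap_def)

lemma G_UNIV: "G UNIV = {}"
  unfolding set_eq_iff mem_G by (auto simp: gap_def)

text \<open>An open interval longer than \<open>\<theta>\<close> that starts below 1 meets the complement of the difference set.\<close>

lemma F_bounded_above:
  assumes "{c - w<..<c} \<subseteq> A" "\<theta> < w" "\<And>x. x \<in> A \<Longrightarrow> x < c"
  shows "F A = {c + 1..}"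
proof (rule Set.set_eqI, rule iffI)
  fix y assume y: "y \<in> F A"
  show "y \<in> {c + 1..}"
  proof (rule ccontr)
    assume "y \<notin> {c + 1..}"
    then have less: "y < c + 1" by simp
    \<comment> \<open>The witness makes \<open>y - x\<close> avoid the gaps. For
      \<open>y < c\<close> it lies above \<open>y\<close>; for
      \<open>c \<le> y < c + \<theta>\<close> the difference is exactly \<open>\<theta>\<close>,
      which is no gap; otherwise \<open>x\<close> is so close to \<open>c\<close> that the
      difference stays between \<open>\<theta>\<close> and 1.\<close>
    define x where "x = (if y - c < 0 then c - min w (c - y) / 2
      else if y - c < \<theta> then y - \<theta> else c - min (w / 2) ((1 - (y - c)) / 2))"
    have w: "0 < w" using assms(2) pos by simp
    have "x \<in> {c - w<..<c}"
      unfolding x_def using w less assms(2) pos by (auto simp: min_def field_simps)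
    then have "gap \<theta> x y" using y assms(1) by (auto simp: mem_F)
    moreover have "\<not> gap \<theta> x y"
      unfolding x_def gap_def using w less assms(2) pos less_half by (auto simp: min_def field_simps)
    ultimately show False by simp
  qed
next
  fix y assume "y \<in> {c + 1..}"
  then show "y \<in> F A" using assms(3) by (fastforce simp: mem_F gap_def)
qed

lemma F_lessThan: "F {..<c} = {c + 1..}"
  by (rule F_bounded_above[of c 1]) (use less_half in auto)

lemma G_atLeast: "G {c + 1..} = {..c}"
proof (rule Set.set_eqI, rule iffI)
  fix x assume x: "x \<in> G {c + 1..}"
  show "x \<in> {..c}"
  proof (rule ccontr)
    assume "x \<notin> {..c}"
    \<comment> \<open>For \<open>x > c\<close> this point of the ray has distance at least
      \<open>\<theta>\<close> and less than 1 from \<open>x\<close>.\<close>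
    then have "max (c + 1) (x + \<theta>) \<in> {c + 1..}" "\<not> gap \<theta> x (max (c + 1) (x + \<theta>))"
      using pos less_half by (auto simp: gap_def max_def)
    then show False using x by (auto simp: mem_G)
  qed
next
  fix x assume "x \<in> {..c}"
  then show "x \<in> G {c + 1..}" by (auto simp: mem_G gap_def)
qed

section \<open>Rays and the two shift operators\<close>

definition ray_beyond :: "real set \<Rightarrow> real set" where
  "ray_beyond A = F (- F A)"

lemma ray_beyond_empty: "ray_beyond {} = UNIV"
  by (simp add: ray_beyond_def)

lemma F_unbounded:
  assumes "\<not> bdd_above A"
  shows "F A = {}"
proof (rule ccontr)
  assume "F A \<noteq> {}"
  then obtain z where "\<forall>x\<in>A. gap \<theta> x z" by (auto simp: mem_F)
  then have "\<forall>x\<in>A. x \<le> z" using pos by (auto simp: gap_def)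
  then show False using assms by (auto simp: bdd_above_def)
qed

lemma ray_beyond_unbounded: "\<not> bdd_above A \<Longrightarrow> ray_beyond A = {}"
  by (simp add: ray_beyond_def F_unbounded F_UNIV)

text \<open>With \<open>c = Sup A\<close>, the set \<open>F A\<close> contains all points from
  \<open>c + 1\<close> on and misses those between \<open>c + \<theta>\<close> and
  \<open>c + 1\<close>, because \<open>A\<close> has points arbitrarily close to \<open>c\<close>.
  So \<open>F_bounded_above\<close> applies to \<open>- F A\<close> with width
  \<open>1 - \<theta>\<close>, which exceeds \<open>\<theta>\<close> as
  \<open>\<theta> < 1 / 2\<close>.\<close>

lemma ray_beyond_bounded:
  assumes "A \<noteq> {}" "bdd_above A"
  shows "ray_beyond A = {Sup A + 2..}"
proof -
  define c where "c = Sup A"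
  have upper: "x \<le> c" if "x \<in> A" for x unfolding c_def using that assms(2) by (rule cSup_upper)
  have 1: "x < c + 1" if "x \<in> - F A" for x
  proof (rule ccontr)
    assume "\<not> x < c + 1"
    then have "\<forall>y\<in>A. 1 \<le> x - y" using upper by fastforce
    then have "x \<in> F A" by (simp add: mem_F gap_def)
    with that show False by simp
  qed
  have 2: "{c + 1 - (1 - \<theta>)<..<c + 1} \<subseteq> - F A"
  proof
    fix y assume y: "y \<in> {c + 1 - (1 - \<theta>)<..<c + 1}"
    then obtain x where x: "x \<in> A" "y - 1 < x"
      using less_cSupD[OF assms(1), of "y - 1"] by (auto simp: c_def)
    then have "\<not> gap \<theta> x y" using upper[of x] y by (auto simp: gap_def)
    then show "y \<in> - F A" using x(1) by (auto simp: mem_F)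
  qed
  have "F (- F A) = {c + 1 + 1..}"
    by (rule F_bounded_above[of _ "1 - \<theta>"]) (use 1 2 less_half in auto)
  then show ?thesis by (simp add: ray_beyond_def c_def)
qed

lemma ray_beyond_cases: obtains "ray_beyond A = {}" | "ray_beyond A = UNIV" | c where "ray_beyond A = {c..}"
  using ray_beyond_empty ray_beyond_unbounded ray_beyond_bounded by metis

definition step :: "real set \<Rightarrow> real set" where
  "step A = ray_beyond (- A)"

text \<open>If \<open>A\<close> is the ray at \<open>c\<close>, then \<open>F (- A)\<close> is the
  ray at \<open>c + 1\<close> and \<open>G\<close> of it meets \<open>A\<close> in the point
  \<open>c\<close> alone. The part of \<open>F {c}\<close> outside the ray at \<open>c + 1\<close>
  is the open interval from \<open>c\<close> to \<open>c + \<theta>\<close>, whose supremum carries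
  \<open>\<theta>\<close>.\<close>

definition long_step :: "real set \<Rightarrow> real set" where
  "long_step A = ray_beyond (F (G (F (- A)) \<inter> A) \<inter> - F (- A))"

lemma step_simps: "step {} = {}" "step UNIV = UNIV" "step {c..} = {c + 2..}"
proof -
  have "\<not> bdd_above (UNIV :: real set)" by (metis UNIV_I bdd_above_def lt_ex not_less gt_ex)
  then show "step {} = {}" by (simp add: step_def ray_beyond_unbounded)
  show "step UNIV = UNIV" by (simp add: step_def ray_beyond_empty)
  have "- {c..} = {..<c}" by auto
  then show "step {c..} = {c + 2..}" by (simp add: step_def ray_beyond_bounded)
qed

lemma long_step_simps: "long_step {} = {}" "long_step UNIV = UNIV" "long_step {c..} = {c + 2 + \<theta>..}"
proof -
  have "\<not> bdd_above (UNIV :: real set)" by (metis UNIV_I bdd_above_def not_less gt_ex)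
  then show "long_step {} = {}" by (simp add: long_step_def F_UNIV ray_beyond_unbounded)
  show "long_step UNIV = UNIV" by (simp add: long_step_def G_UNIV ray_beyond_empty)
  have "- {c..} = {..<c}" by auto
  moreover have "{..c} \<inter> {c..} = {c}" by auto
  moreover have "F {c} \<inter> - {c + 1..} = {c<..<c + \<theta>}"
    unfolding set_eq_iff using less_half pos by (auto simp: mem_F gap_def)
  moreover have "ray_beyond {c<..<c + \<theta>} = {c + \<theta> + 2..}"
    using pos by (subst ray_beyond_bounded) auto
  ultimately have "long_step {c..} = {c + \<theta> + 2..}"
    by (simp add: long_step_def F_lessThan G_atLeast)
  then show "long_step {c..} = {c + 2 + \<theta>..}" by (simp add: add_ac)
qed

text \<open>\<open>{}\<close> and \<open>UNIV\<close> are the degenerate values of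
  \<open>ray_beyond\<close>. Both shifts fix them, so a comparison of iterates is decided by proper
  rays.\<close>

lemma step_funpow: "(step ^^ n) {} = {}" "(step ^^ n) UNIV = UNIV" "(step ^^ n) {c..} = {c + 2 * real n..}"
  by (induction n) (simp_all add: step_simps algebra_simps)

lemma long_step_funpow:
  "(long_step ^^ n) {} = {}" "(long_step ^^ n) UNIV = UNIV" "(long_step ^^ n) {c..} = {c + (2 + \<theta>) * real n..}"
  by (induction n) (simp_all add: long_step_simps algebra_simps)

end

section \<open>Vertex parts of compositions\<close>

lemma bex_option: "(\<exists>a\<in>X. Q a) \<longleftrightarrow> None \<in> X \<and> Q None \<or> (\<exists>x\<in>verts X. Q (Some x))"
  by (simp add: Bex_def split_option_ex mem_verts)

lemma option_set_eqI:
  assumes "verts X = verts Y" "None \<in> X \<longleftrightarrow> None \<in> Y"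
  shows "X = Y"
proof (rule Set.set_eqI)
  fix c show "c \<in> X \<longleftrightarrow> c \<in> Y"
    using assms(2) arg_cong[OF assms(1), of "\<lambda>A. the c \<in> A"] by (cases c) (simp_all add: mem_verts)
qed

text \<open>A cycle of three vertices has two equal members; the three possibilities give the last
  three sets. Composition is thereby reduced to Boolean operations, \<open>dominated\<close> and
  \<open>dominating\<close>.\<close>

lemma (in total_graph) verts_comp:
  "verts (X \<bullet>\<^bsub>complex_algebra R\<^esub> Y) =
     (if None \<in> X then verts Y else {}) \<union> (if None \<in> Y then verts X else {})
     \<union> - dominated R (verts X \<inter> verts Y)
     \<union> (verts X \<inter> - dominating R (verts Y)) \<union> (verts Y \<inter> - dominating R (verts X))"
proof (rule Set.set_eqI)
  fix z
  have "z \<in> verts (X \<bullet>\<^bsub>complex_algebra R\<^esub> Y) \<longleftrightarrow> (\<exists>a\<in>X. \<exists>b\<in>Y. cycle R a b (Some z))"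
    by (simp add: mem_verts complex_algebra_comp)
  also have "\<dots> \<longleftrightarrow> (None \<in> X \<and> z \<in> verts Y) \<or> (None \<in> Y \<and> z \<in> verts X)
      \<or> (\<exists>x\<in>verts X. \<exists>y\<in>verts Y. x = y \<and> R x z \<or> x = z \<and> R x y \<or> y = z \<and> R y x)"
    unfolding bex_option[of X] bex_option[of Y] by (simp add: mem_verts[symmetric] bex_disj_distrib)
  also have "\<dots> \<longleftrightarrow> z \<in> (if None \<in> X then verts Y else {}) \<union> (if None \<in> Y then verts X else {})
     \<union> - dominated R (verts X \<inter> verts Y)
     \<union> (verts X \<inter> - dominating R (verts Y)) \<union> (verts Y \<inter> - dominating R (verts X))"
  proof -
    have "(\<exists>x\<in>verts X. \<exists>y\<in>verts Y. x = y \<and> R x z \<or> x = z \<and> R x y \<or> y = z \<and> R y x)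
      \<longleftrightarrow> (\<exists>x\<in>verts X \<inter> verts Y. R x z) \<or> z \<in> verts X \<and> (\<exists>y\<in>verts Y. R z y)
        \<or> z \<in> verts Y \<and> (\<exists>x\<in>verts X. R z x)"
      by blast
    then show ?thesis by (simp add: dominated_def dominating_def disj_assoc)
  qed
  finally show "z \<in> verts (X \<bullet>\<^bsub>complex_algebra R\<^esub> Y) \<longleftrightarrow> z \<in> (if None \<in> X then verts Y else {})
     \<union> (if None \<in> Y then verts X else {}) \<union> - dominated R (verts X \<inter> verts Y)
     \<union> (verts X \<inter> - dominating R (verts Y)) \<union> (verts Y \<inter> - dominating R (verts X))" .
qed

section \<open>Terms for the operators and the four-element subalgebra\<close>

definition ray_beyond_term :: "trm \<Rightarrow> trm" where
  "ray_beyond_term t = dominated_term (Compl (dominated_term t))"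

definition step_term :: "trm \<Rightarrow> trm" where
  "step_term t = ray_beyond_term (Compl t)"

definition long_step_term :: "trm \<Rightarrow> trm" where
  "long_step_term t = ray_beyond_term
     (Meet (dominated_term (Meet (dominating_term (dominated_term (Compl t))) t))
       (Compl (dominated_term (Compl t))))"

definition diff_term :: "trm \<Rightarrow> trm \<Rightarrow> trm" where
  "diff_term s t = Join (Meet s (Compl t)) (Meet t (Compl s))"

text \<open>In complex algebras of total graphs this is the unary discriminator: 0 at 0 and 1 at
  every other element.\<close>

definition support_term :: "trm \<Rightarrow> trm" where
  "support_term t = Comp (Comp One t) One"

definition four_embedding :: "bool \<times> bool \<Rightarrow> 'v option set" where
  "four_embedding = (\<lambda>(a, b). (if a then {None} else {}) \<union> (if b then range Some else {}))"

lemma four_embedding_simps [simp]: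
  "verts (four_embedding (a, b) :: 'v option set) = (if b then UNIV else {})"
  "None \<in> (four_embedding (a, b) :: 'v option set) \<longleftrightarrow> a"
  by (auto simp: four_embedding_def mem_verts)

lemma range_four_embedding: "X \<in> range four_embedding \<longleftrightarrow> verts X = {} \<or> verts X = UNIV"
proof
  assume "X \<in> range four_embedding"
  then obtain a b where "X = four_embedding (a, b)" by (metis imageE surj_pair)
  then show "verts X = {} \<or> verts X = UNIV" by simp
next
  assume *: "verts X = {} \<or> verts X = UNIV"
  have "X = four_embedding (None \<in> X, verts X = UNIV)"
    by (rule option_set_eqI) (use * in auto)
  then show "X \<in> range four_embedding" by blast
qed

lemma inj_four_embedding: "inj (four_embedding :: bool \<times> bool \<Rightarrow> 'v option set)"
proof (rule injI)
  fix x y assume *: "four_embedding x = (four_embedding y :: 'v option set)"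
  obtain a b a' b' where xy: "x = (a, b)" "y = (a', b')" by (metis surj_pair)
  have "verts (four_embedding x) = verts (four_embedding y :: 'v option set)"
    "None \<in> (four_embedding x :: 'v option set) \<longleftrightarrow> None \<in> (four_embedding y :: 'v option set)"
    by (simp_all only: *)
  then show "x = y" by (auto simp: xy split: if_splits)
qed

text \<open>By reflexivity no vertex dominates, or is dominated by, the set of all vertices. Hence
  the square of the diversity element is 1, as in \<open>four\<close>.\<close>

lemma (in total_graph) hom_four_embedding: "ra_hom four (complex_algebra R) four_embedding"
proof -
  let ?h = "four_embedding :: _ \<Rightarrow> 'v option set"
  have None_comp: "None \<in> X \<bullet>\<^bsub>complex_algebra R\<^esub> Y \<longleftrightarrow> None \<in> X \<and> None \<in> Y \<or> verts X \<inter> verts Y \<noteq> {}" for X Y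
    unfolding complex_algebra_comp mem_Collect_eq bex_option[of X] bex_option[of Y] by auto
  have trivial: "dominated R UNIV = {}" "dominating R UNIV = {}" "dominating R {} = UNIV"
    using refl by (auto simp: dominated_def dominating_def)
  have "?h (x \<bullet>\<^bsub>four\<^esub> y) = ?h x \<bullet>\<^bsub>complex_algebra R\<^esub> ?h y" "?h (x \<^bold>\<or>\<^bsub>four\<^esub> y) = ?h x \<union> ?h y"
    "?h (x \<^bold>\<and>\<^bsub>four\<^esub> y) = ?h x \<inter> ?h y" "?h (\<sim>\<^bsub>four\<^esub> x) = - ?h x" for x y
    by (cases x; cases y; rule option_set_eqI; simp add: four_def None_comp verts_comp trivial)+
  moreover have "?h (False, False) = {}" "?h (True, True) = UNIV" "?h (True, False) = {None}"
    by (rule option_set_eqI; simp)+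
  ultimately show ?thesis
    unfolding ra_hom_def by (simp add: four_def)
qed

section \<open>The varieties of the line algebras\<close>

definition eventually_constant :: "real set \<Rightarrow> bool" where
  "eventually_constant A \<longleftrightarrow> (\<exists>M. \<forall>z>M. z \<in> A) \<or> (\<exists>M. \<forall>z>M. z \<notin> A)"

lemma eventually_constant_Compl: "eventually_constant A \<Longrightarrow> eventually_constant (- A)"
  by (auto simp: eventually_constant_def)

lemma eventually_constant_Un:
  assumes "eventually_constant A" "eventually_constant B"
  shows "eventually_constant (A \<union> B)"
proof -
  consider M where "\<forall>z>M. z \<in> A" | M where "\<forall>z>M. z \<in> B"
    | M N where "\<forall>z>M. z \<notin> A" "\<forall>z>N. z \<notin> B"
    using assms by (auto simp: eventually_constant_def)
  then show ?thesis
  proof cases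
    case 3
    then have "\<forall>z>max M N. z \<notin> A \<union> B" by simp
    then show ?thesis unfolding eventually_constant_def by blast
  qed (auto simp: eventually_constant_def)
qed

lemma eventually_constant_Int:
  "eventually_constant A \<Longrightarrow> eventually_constant B \<Longrightarrow> eventually_constant (A \<inter> B)"
  using eventually_constant_Compl[OF eventually_constant_Un[of "- A" "- B"]] by (simp add: eventually_constant_Compl)

lemma eventually_constant_empty: "eventually_constant {}"
  by (auto simp: eventually_constant_def)

context real_frame
begin

lemma eventually_constant_F: "eventually_constant (F A)"
proof (cases "bdd_above A")
  case True
  then obtain M where "\<forall>x\<in>A. x \<le> M" by (auto simp: bdd_above_def)
  then have "\<forall>z>M + 1. z \<in> F A" by (fastforce simp: mem_F gap_def)
  then show ?thesis unfolding eventually_constant_def by blast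
next
  case False
  then show ?thesis using F_unbounded by (simp add: eventually_constant_empty)
qed

lemma eventually_constant_G: "eventually_constant (G A)"
proof (cases "A = {}")
  case True
  then show ?thesis by (auto simp: eventually_constant_def dominating_def)
next
  case False
  then obtain a where "a \<in> A" by blast
  then have "\<forall>z>a. z \<notin> G A" using pos by (auto simp: mem_G gap_def intro!: bexI[of _ a])
  then show ?thesis unfolding eventually_constant_def by blast
qed

text \<open>By \<open>verts_comp\<close> every operation acts on vertex parts through Boolean
  operations, \<open>F\<close> and \<open>G\<close>, and the last two give eventually constant sets
  for arbitrary arguments.\<close>

lemma eventually_constant_eval: "eventually_constant (verts (eval CA (\<lambda>_. Some ` {0..}) t))"
proof (induction t)
  case (Var n)
  then show ?case by (auto simp: eventually_constant_def intro!: exI[of _ 0])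
next
  case (Comp s t)
  then show ?case
    unfolding eval.simps verts_comp
    by (simp add: eventually_constant_Un eventually_constant_Int eventually_constant_Compl
        eventually_constant_F eventually_constant_G eventually_constant_empty)
next
  case One
  then show ?case using eventually_constant_Compl[OF eventually_constant_empty] by simp
qed (simp_all add: eventually_constant_Un eventually_constant_Int eventually_constant_Compl eventually_constant_empty)

section \<open>The algebra generated by a ray, given by the values of terms\<close>

definition line_algebra :: "real option set ra" where
  "line_algebra = CA\<lparr>carrier := range (eval CA (\<lambda>_. Some ` {0..}))\<rparr>"

lemma carrier_line_algebra: "carrier line_algebra = range (eval CA (\<lambda>_. Some ` {0..}))"
  by (simp add: line_algebra_def)

lemma eval_line_algebra: "eval line_algebra = eval CA"
  by (intro ext) (simp add: line_algebra_def eval_carrier_update)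

lemma algebra_line_algebra: "algebra line_algebra"
proof -
  let ?e = "eval CA (\<lambda>_. Some ` {0..})"
  have "?e s \<union> ?e t \<in> range ?e" "?e s \<inter> ?e t \<in> range ?e" "?e s \<bullet>\<^bsub>CA\<^esub> ?e t \<in> range ?e"
    "- ?e t \<in> range ?e" "{} \<in> range ?e" "UNIV \<in> range ?e" "{None} \<in> range ?e" for s t
    using rangeI[of ?e "Join s t"] rangeI[of ?e "Meet s t"] rangeI[of ?e "Comp s t"]
      rangeI[of ?e "Compl t"] rangeI[of ?e Zero] rangeI[of ?e One] rangeI[of ?e Ident] by simp_all
  then show ?thesis
    unfolding algebra_def subuniverse_def line_algebra_def by auto
qed

lemma line_algebra_identityI:
  "(\<And>\<rho>. eval CA \<rho> s = eval CA \<rho> t) \<Longrightarrow> (s, t) \<in> identities line_algebra"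
  by (rule identitiesI) (simp add: eval_line_algebra)

lemma RSA_axioms_line_algebra: "RSA_axioms \<subseteq> identities line_algebra"
proof -
  have "RSA_axioms \<subseteq> identities CA"
    using complex_algebra_RSA by (simp add: RSA_eq_models in_models_iff)
  then show ?thesis
    by (auto simp: identities_def satisfies_def eval_line_algebra)
qed

lemma eval_support_term:
  "eval CA \<rho> (support_term t) = (if eval CA \<rho> t = {} then {} else UNIV)"
  by (simp add: support_term_def comp_one)

lemma eval_diff_term_eq_empty: "eval CA \<rho> (diff_term s t) = {} \<longleftrightarrow> eval CA \<rho> s = eval CA \<rho> t"
  by (auto simp: diff_term_def)

lemma eval_ray_beyond_term: "eval CA \<rho> (ray_beyond_term t) = Some ` ray_beyond (verts (eval CA \<rho> t))"
  by (simp add: ray_beyond_term_def eval_dominated_term ray_beyond_def)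

lemma eval_step_term: "eval CA \<rho> (step_term t) = Some ` step (verts (eval CA \<rho> t))"
  by (simp add: step_term_def eval_ray_beyond_term step_def)

lemma eval_long_step_term: "eval CA \<rho> (long_step_term t) = Some ` long_step (verts (eval CA \<rho> t))"
  by (simp add: long_step_term_def eval_ray_beyond_term eval_dominated_term eval_dominating_term long_step_def)

text \<open>The vertex part and its complement are both nonempty, and eventual constancy bounds one
  of them above.\<close>

lemma ray_from_nontrivial:
  assumes "X \<in> carrier line_algebra" "X \<notin> range four_embedding"
  shows "\<exists>c. ray_beyond (verts X) = {c..} \<or> ray_beyond (- verts X) = {c..}"
proof -
  have ne: "verts X \<noteq> {}" "- verts X \<noteq> {}" using assms(2) by (auto simp: range_four_embedding)
  have "eventually_constant (verts X)"
    using assms(1) eventually_constant_eval by (auto simp: carrier_line_algebra)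
  then consider M where "\<forall>z>M. z \<in> verts X" | M where "\<forall>z>M. z \<notin> verts X"
    by (auto simp: eventually_constant_def)
  then have "bdd_above (- verts X) \<or> bdd_above (verts X)"
  proof cases
    case 1
    then have "\<forall>z\<in>- verts X. z \<le> M" by (meson ComplD not_le_imp_less)
    then show ?thesis by (auto simp: bdd_above_def)
  next
    case 2
    then have "\<forall>z\<in>verts X. z \<le> M" by (meson not_le_imp_less)
    then show ?thesis by (auto simp: bdd_above_def)
  qed
  then show ?thesis using ray_beyond_bounded[of "- verts X"] ray_beyond_bounded[of "verts X"] ne by auto
qed

lemma eval_translated_ray:
  "eval CA (\<lambda>_. Some ` {c..}) t = map_option ((+) c) ` eval CA (\<lambda>_. Some ` {0..}) t"
proof -
  have "map_option ((+) c) ` Some ` {0..} = Some ` (+) c ` {0..}"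
    by (simp only: image_image option.map)
  also have "\<dots> = Some ` {c..}" by (simp only: image_add_atLeast add_0_right)
  finally have "eval CA (\<lambda>_. Some ` {c..}) t = eval CA (\<lambda>_. map_option ((+) c) ` Some ` {0..}) t"
    by simp
  also have "\<dots> = map_option ((+) c) ` eval CA (\<lambda>_. Some ` {0..}) t"
    by (rule eval_translate) (simp_all add: edge_def gap_def)
  finally show ?thesis .
qed

lemma four_embedding_line_algebra: "ra_hom four line_algebra four_embedding"
proof -
  have "four_embedding x \<in> carrier line_algebra" for x
  proof -
    have "range Some = - {None}" by (auto simp: notin_range_Some)
    then have "four_embedding x = eval CA (\<lambda>_. Some ` {0..})
      (Join (if fst x then Ident else Zero) (if snd x then Compl Ident else Zero))"
      by (auto simp: four_embedding_def split: prod.splits)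
    then show ?thesis unfolding carrier_line_algebra by blast
  qed
  then show ?thesis using hom_four_embedding by (simp add: ra_hom_def line_algebra_def)
qed

lemma identities_line_algebra_four: "identities line_algebra \<subset> identities four"
proof -
  \<comment> \<open>The equation \<open>?s = Zero\<close> says that an element or its complement
    contains no vertices. It holds in \<open>four\<close>; the generating ray, which contains 0 but
    not -1, violates it.\<close>
  let ?s = "Meet (support_term (Meet (Var 0) (Compl Ident))) (support_term (Meet (Compl (Var 0)) (Compl Ident)))"
  have "identities line_algebra \<subseteq> identities four"
    by (rule identities_of_embedded[OF four_embedding_line_algebra algebra_four inj_on_subset[OF inj_four_embedding subset_UNIV]])
  moreover have "(?s, Zero) \<in> identities four"
    by (rule identitiesI) (auto simp: four_def support_term_def split: prod.splits)
  moreover have "(?s, Zero) \<notin> identities line_algebra"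
  proof
    assume "(?s, Zero) \<in> identities line_algebra"
    moreover have "range (\<lambda>_. Some ` {0..}) \<subseteq> carrier line_algebra"
      unfolding carrier_line_algebra using rangeI[of "eval CA (\<lambda>_. Some ` {0..})" "Var 0"] by auto
    ultimately have "eval line_algebra (\<lambda>_. Some ` {0..}) ?s = eval line_algebra (\<lambda>_. Some ` {0..}) Zero"
      by (rule identitiesD)
    moreover have "Some 0 \<in> Some ` {0 :: real..}" "Some (-1) \<notin> Some ` {0 :: real..}" by auto
    ultimately show False
      by (auto simp: eval_line_algebra eval_support_term split: if_splits)
  qed
  ultimately show ?thesis by blast
qed

end

section \<open>Proper subvarieties of a line variety\<close>

primrec join_below :: "(nat \<Rightarrow> trm) \<Rightarrow> nat \<Rightarrow> trm" where
  "join_below f 0 = Zero"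
| "join_below f (Suc n) = Join (join_below f n) (f n)"

context real_frame
begin

text \<open>At the ray at \<open>c\<close> a term takes the translate by \<open>c\<close> of its
  value at the generator, and translates of nonempty sets are nonempty.\<close>

lemma support_at_ray:
  assumes "eval CA (\<lambda>_. Some ` {0..}) (diff_term u v) \<noteq> {}" "eval CA \<rho> q = Some ` {c..}"
  shows "eval CA \<rho> (support_term (subst (\<lambda>_. q) (diff_term u v))) = UNIV"
proof -
  have "eval CA \<rho> (subst (\<lambda>_. q) (diff_term u v))
      = map_option ((+) c) ` eval CA (\<lambda>_. Some ` {0..}) (diff_term u v)"
    unfolding eval_subst assms(2) by (rule eval_translated_ray)
  then have "eval CA \<rho> (subst (\<lambda>_. q) (diff_term u v)) \<noteq> {}"
    using assms(1) by simp
  then show ?thesis by (simp add: eval_support_term)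
qed

text \<open>
  If \<open>s = t\<close> holds in the four-element algebra, then in the line algebra \<open>s\<close> and \<open>t\<close> can only
  differ if some variable has a nontrivial value. Such a value yields a ray, that is, a
  translate of the generator, and so a failure of \<open>u = v\<close>. This implication is expressed by an
  identity and hence is inherited by all members of the variety.
\<close>

lemma identity_of_four_transfers:
  assumes C: "C \<in> models (identities line_algebra)"
    and st: "(s, t) \<in> identities four"
    and uv: "(u, v) \<notin> identities line_algebra" "(u, v) \<in> identities C"
  shows "(s, t) \<in> identities C"
proof -
  have idC: "(p, q) \<in> identities C" if "\<And>\<rho>. eval CA \<rho> p = eval CA \<rho> q" for p q
    using C line_algebra_identityI[OF that] unfolding in_models_iff by blast
  have algC: "algebra C" using C by (simp add: in_models_iff)
  obtain \<tau> where \<tau>: "range \<tau> \<subseteq> carrier line_algebra" "eval CA \<tau> u \<noteq> eval CA \<tau> v"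
    using uv(1) by (auto simp: identities_def satisfies_def eval_line_algebra)
  then have "\<forall>n. \<exists>w. \<tau> n = eval CA (\<lambda>_. Some ` {0..}) w" by (auto simp: carrier_line_algebra)
  then obtain \<sigma> where \<sigma>: "\<tau> = (\<lambda>n. eval CA (\<lambda>_. Some ` {0..}) (\<sigma> n))" by metis
  \<comment> \<open>Elements of the line algebra are values of terms at the generator, so the
    failure of \<open>u = v\<close> turns into a nonzero value of the one-generator term
    \<open>?d\<close>. Then \<open>?\<Phi> q\<close> is 1 whenever \<open>q\<close> is a ray, and
    \<open>?f i\<close> tries the rays obtained from variable \<open>i\<close> and from its
    complement.\<close>
  let ?d = "diff_term (subst \<sigma> u) (subst \<sigma> v)"
  let ?\<Phi> = "\<lambda>q. support_term (subst (\<lambda>_. q) ?d)"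
  let ?f = "\<lambda>i. Join (?\<Phi> (ray_beyond_term (Var i))) (?\<Phi> (ray_beyond_term (Compl (Var i))))"
  have d: "eval CA (\<lambda>_. Some ` {0..}) ?d \<noteq> {}"
    using \<tau>(2) unfolding eval_diff_term_eq_empty \<sigma> eval_subst .
  obtain M where M: "\<And>\<rho> \<rho>'. \<forall>i<M. \<rho> i = \<rho>' i \<Longrightarrow> eval CA \<rho> s = eval CA \<rho>' s"
    using finitely_many_variables by metis
  obtain N where N: "\<And>\<rho> \<rho>'. \<forall>i<N. \<rho> i = \<rho>' i \<Longrightarrow> eval CA \<rho> t = eval CA \<rho>' t"
    using finitely_many_variables by metis
  \<comment> \<open>This says that the difference of \<open>s\<close> and \<open>t\<close> lies
    below the join of all \<open>?f i\<close>: where \<open>s\<close> and \<open>t\<close> differ,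
    the join is 1.\<close>
  have "(Meet (diff_term s t) (join_below ?f (M + N)), diff_term s t) \<in> identities line_algebra"
  proof (rule identitiesI)
    fix \<rho> :: "nat \<Rightarrow> real option set" assume \<rho>: "range \<rho> \<subseteq> carrier line_algebra"
    have "eval CA \<rho> (join_below ?f (M + N)) = UNIV" if "eval CA \<rho> s \<noteq> eval CA \<rho> t"
    proof -
      have "\<exists>i<M + N. \<rho> i \<notin> range four_embedding"
      proof (rule ccontr)
        assume *: "\<not> (\<exists>i<M + N. \<rho> i \<notin> range four_embedding)"
        \<comment> \<open>Variables beyond the bound get the unit as a default, so that every value
          lies in the four-element subalgebra.\<close>
        define \<rho>' where "\<rho>' i = (if i < M + N then \<rho> i else four_embedding (True, True))" for i
        have "\<rho>' i \<in> range four_embedding" for i using * by (auto simp: \<rho>'_def)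
        then have "range \<rho>' \<subseteq> four_embedding ` carrier four" by (auto simp: four_def)
        then have "eval CA \<rho>' s = eval CA \<rho>' t"
          by (rule eval_eq_in_hom_image[OF hom_four_embedding algebra_four st])
        moreover have "eval CA \<rho> s = eval CA \<rho>' s" by (rule M) (simp add: \<rho>'_def)
        moreover have "eval CA \<rho> t = eval CA \<rho>' t" by (rule N) (simp add: \<rho>'_def)
        ultimately show False using that by simp
      qed
      then obtain i where i: "i < M + N" "\<rho> i \<notin> range four_embedding" by blast
      moreover have "\<rho> i \<in> carrier line_algebra" using \<rho> by auto
      ultimately obtain c where "ray_beyond (verts (\<rho> i)) = {c..} \<or> ray_beyond (- verts (\<rho> i)) = {c..}"
        using ray_from_nontrivial by blast
      then have "eval CA \<rho> (ray_beyond_term (Var i)) = Some ` {c..} \<or> eval CA \<rho> (ray_beyond_term (Compl (Var i))) = Some ` {c..}"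
        unfolding eval_ray_beyond_term by (elim disjE) simp_all
      then have "eval CA \<rho> (?f i) = UNIV" using support_at_ray[OF d] by auto
      moreover have "eval CA \<rho> (?f i) \<subseteq> eval CA \<rho> (join_below ?f n)" if "i < n" for n
        using that by (induction n) (auto simp: less_Suc_eq)
      ultimately show ?thesis using i(1) by auto
    qed
    then show "eval line_algebra \<rho> (Meet (diff_term s t) (join_below ?f (M + N))) = eval line_algebra \<rho> (diff_term s t)"
      using eval_diff_term_eq_empty[of \<rho> s t] by (cases "eval CA \<rho> s = eval CA \<rho> t") (simp_all add: eval_line_algebra)
  qed
  then have meet: "(Meet (diff_term s t) (join_below ?f (M + N)), diff_term s t) \<in> identities C"
    using C unfolding in_models_iff by blast
  show ?thesis
  proof (rule identitiesI)
    fix \<rho> :: "nat \<Rightarrow> _" assume \<rho>: "range \<rho> \<subseteq> carrier C"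
    have eq: "eval C \<rho> p = eval C \<rho> q" if "\<And>\<rho>. eval CA \<rho> p = eval CA \<rho> q" for p q
      using idC[OF that] \<rho> by (rule identitiesD)
    \<comment> \<open>In \<open>C\<close> the identity \<open>u = v\<close> makes every
      \<open>?\<Phi> q\<close> vanish. The inherited identity then forces the difference of
      \<open>s\<close> and \<open>t\<close> to be 0.\<close>
    have "eval C \<rho> (?\<Phi> q) = eval C \<rho> Zero" for q
    proof -
      let ?u = "subst (\<lambda>_. q) (subst \<sigma> u)" and ?v = "subst (\<lambda>_. q) (subst \<sigma> v)"
      have "eval C \<rho> ?u = eval C \<rho> ?v"
        by (intro identitiesD[OF identities_subst[OF algC identities_subst[OF algC uv(2)]] \<rho>])
      then have "eval C \<rho> (?\<Phi> q) = eval C \<rho> (support_term (diff_term ?v ?v))"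
        by (simp add: support_term_def diff_term_def)
      also have "\<dots> = eval C \<rho> Zero"
        by (rule eq) (simp add: eval_support_term eval_diff_term_eq_empty)
      finally show ?thesis .
    qed
    then have f: "eval C \<rho> (?f i) = eval C \<rho> (Join Zero Zero)" for i by simp
    have Join_Zero: "eval C \<rho> (Join p Zero) = eval C \<rho> p" for p by (rule eq) simp
    have "eval C \<rho> (join_below ?f n) = eval C \<rho> Zero" for n
    proof (induction n)
      case (Suc n)
      then show ?case using f[of n] Join_Zero[of Zero] by simp
    qed simp
    moreover have "eval C \<rho> (Meet (diff_term s t) Zero) = eval C \<rho> Zero" by (rule eq) simp
    ultimately have "eval C \<rho> (diff_term s t) = eval C \<rho> Zero"
      using identitiesD[OF meet \<rho>] by simp
    moreover have "eval C \<rho> (Join s (diff_term s t)) = eval C \<rho> (Join t (diff_term s t))"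
      by (rule eq) (auto simp: diff_term_def)
    ultimately show "eval C \<rho> s = eval C \<rho> t"
      using Join_Zero[of s] Join_Zero[of t] by simp
  qed
qed

text \<open>A subvariety not below \<open>?W\<close> has a member in which some identity of
  \<open>four\<close> fails. By \<open>identity_of_four_transfers\<close> all identities of this
  member hold in the line algebra, so the subvariety is all of \<open>?V\<close>.\<close>

lemma line_variety_is_join_irreducible_cover:
  fixes K :: "'a::infinite ra set"
  assumes "K = models E" "E \<subseteq> RSA_axioms"
  shows "models (identities line_algebra) \<in> join_irreducible_covers (subvariety_lattice K) (models (identities four))"
proof (rule join_irreducible_coverI[OF assms(1)])
  let ?V = "models (identities line_algebra) :: 'a ra set" and ?W = "models (identities four) :: 'a ra set"
  show "variety ?W" "variety ?V" by (auto simp: variety_def)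
  have less: "identities line_algebra \<subseteq> identities four" "\<not> identities four \<subseteq> identities line_algebra"
    using identities_line_algebra_four by (simp_all add: less_le_not_le)
  show "?V \<subseteq> K"
    unfolding assms(1) by (rule models_antimono[OF order.trans[OF assms(2) RSA_axioms_line_algebra]])
  \<comment> \<open>Strictness has to be witnessed over the given carrier type.\<close>
  obtain C :: "'a ra" where C: "algebra C" "identities C = identities line_algebra"
    using ex_algebra_with_identities[OF algebra_line_algebra] .
  have "C \<in> ?V" "C \<notin> ?W" using less(2) by (simp_all add: in_models_iff C)
  then have "?W \<noteq> ?V" by metis
  then show "?W \<subset> ?V" using models_antimono[OF less(1)] by (simp add: psubset_eq)
  fix c :: "'a ra set" assume c: "variety c" "c \<subset> ?V"
  then obtain E' where E': "c = models E'" by (auto simp: variety_def)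
  show "c \<subseteq> ?W"
  proof
    fix C assume "C \<in> c"
    show "C \<in> ?W"
    proof (rule ccontr)
      assume "C \<notin> ?W"
      moreover have CV: "C \<in> ?V" using c(2) \<open>C \<in> c\<close> by (rule psubsetD)
      ultimately have "\<not> identities four \<subseteq> identities C" by (simp add: in_models_iff)
      then obtain s t where st: "(s, t) \<in> identities four" "(s, t) \<notin> identities C" by auto
      have "E' \<subseteq> identities line_algebra"
      proof (rule subrelI)
        fix u v assume "(u, v) \<in> E'"
        moreover have "E' \<subseteq> identities C" using \<open>C \<in> c\<close> by (simp add: E' in_models_iff)
        ultimately have "(u, v) \<in> identities C" by (rule rev_subsetD)
        then show "(u, v) \<in> identities line_algebra"
          using identity_of_four_transfers[OF CV st(1)] st(2) by blast
      qed
      then have "?V \<subseteq> c" unfolding E' by (rule models_antimono)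
      with c(2) show False by (simp add: less_le_not_le)
    qed
  qed
qed

section \<open>Recovering \<open>\<theta>\<close> from the identities\<close>

definition compare_term :: "nat \<Rightarrow> nat \<Rightarrow> trm" where
  "compare_term n m = Meet ((step_term ^^ n) (ray_beyond_term (Var 0))) (Compl ((long_step_term ^^ m) (ray_beyond_term (Var 0))))"

lemma eval_funpow_step_term:
  "eval CA \<rho> ((step_term ^^ n) (ray_beyond_term t)) = Some ` (step ^^ n) (ray_beyond (verts (eval CA \<rho> t)))"
  by (induction n) (simp_all add: eval_step_term eval_ray_beyond_term)

lemma eval_funpow_long_step_term:
  "eval CA \<rho> ((long_step_term ^^ n) (ray_beyond_term t)) = Some ` (long_step ^^ n) (ray_beyond (verts (eval CA \<rho> t)))"
  by (induction n) (simp_all add: eval_long_step_term eval_ray_beyond_term)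

lemma eval_compare_term:
  "eval CA \<rho> (compare_term n m)
     = Some ` ((step ^^ n) (ray_beyond (verts (\<rho> 0))) - (long_step ^^ m) (ray_beyond (verts (\<rho> 0))))"
  by (auto simp: compare_term_def eval_funpow_step_term eval_funpow_long_step_term)

lemma compare_term_identity:
  "(compare_term n m, Zero) \<in> identities line_algebra \<longleftrightarrow> (2 + \<theta>) * real m \<le> 2 * real n"
proof
  assume "(compare_term n m, Zero) \<in> identities line_algebra"
  \<comment> \<open>The complement of the generator is used because its vertex part is bounded
    above, with supremum 0; \<open>ray_beyond\<close> gives the ray at 2.\<close>
  moreover have "range (\<lambda>_. - Some ` {0..}) \<subseteq> carrier line_algebra"
    unfolding carrier_line_algebra using rangeI[of "eval CA (\<lambda>_. Some ` {0..})" "Compl (Var 0)"] by auto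
  ultimately have "eval line_algebra (\<lambda>_. - Some ` {0..}) (compare_term n m) = eval line_algebra (\<lambda>_. - Some ` {0..}) Zero"
    by (rule identitiesD)
  moreover have "- {0 :: real..} = {..<0}" by auto
  ultimately have "{2 + 2 * real n..} \<subseteq> {2 + (2 + \<theta>) * real m..}"
    by (simp add: eval_line_algebra eval_compare_term ray_beyond_bounded step_funpow long_step_funpow)
  then show "(2 + \<theta>) * real m \<le> 2 * real n" by simp
next
  assume le: "(2 + \<theta>) * real m \<le> 2 * real n"
  have "(step ^^ n) (ray_beyond A) \<subseteq> (long_step ^^ m) (ray_beyond A)" for A
    by (rule ray_beyond_cases[of A]) (use le in \<open>simp_all add: step_funpow long_step_funpow\<close>)
  then show "(compare_term n m, Zero) \<in> identities line_algebra"
    by (intro line_algebra_identityI) (simp add: eval_compare_term)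
qed

end

text \<open>For large \<open>m\<close> the numbers \<open>m * \<theta> / 2\<close> and
  \<open>m * \<theta>' / 2\<close> are more than 1 apart. An integer \<open>k\<close> between them
  gives a comparison with \<open>n = m + k\<close> that holds for \<open>\<theta>\<close> but fails
  for \<open>\<theta>'\<close>.\<close>

lemma identities_line_algebra_inj:
  assumes "real_frame \<theta>" "real_frame \<theta>'" "\<theta> < \<theta>'"
  shows "identities (real_frame.line_algebra \<theta>) \<noteq> identities (real_frame.line_algebra \<theta>')"
proof -
  interpret a: real_frame \<theta> by fact
  interpret b: real_frame \<theta>' by fact
  obtain m :: nat where m: "2 < real m * (\<theta>' - \<theta>)"
    using reals_Archimedean3[of "\<theta>' - \<theta>"] assms(3) by auto
  define k where "k = nat \<lceil>real m * \<theta> / 2\<rceil>"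
  have "0 \<le> real m * \<theta> / 2" using a.pos by simp
  then have k: "real m * \<theta> / 2 \<le> real k" "real k < real m * \<theta> / 2 + 1"
    unfolding k_def by linarith+
  have "(2 + \<theta>) * real m \<le> 2 * real (m + k)" "\<not> (2 + \<theta>') * real m \<le> 2 * real (m + k)"
    using k m by (simp_all add: algebra_simps)
  then show ?thesis using a.compare_term_identity b.compare_term_identity by metis
qed

section \<open>Counting the covers\<close>

lemma join_irreducible_covers_eqpoll:
  fixes K :: "'a::infinite ra set"
  assumes "K = models E" "E \<subseteq> RSA_axioms"
  shows "join_irreducible_covers (subvariety_lattice K) (models (identities four)) \<approx> (UNIV :: nat set set)"
proof (rule lepoll_antisym)
  let ?J = "join_irreducible_covers (subvariety_lattice K) (models (identities four))"
  have "?J \<subseteq> {V. variety V}"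
    by (auto simp: join_irreducible_covers_def covers_def subvariety_lattice_def)
  then show "?J \<lesssim> (UNIV :: nat set set)"
    using subset_imp_lepoll varieties_lepoll lepoll_trans by blast
  \<comment> \<open>The parameter \<open>(r + 1) / 8\<close> carries the unit interval into the
    admissible range between 0 and 1/2.\<close>
  define h where "h r = (models (identities (real_frame.line_algebra ((r + 1) / 8))) :: 'a ra set)" for r
  have frame: "real_frame ((r + 1) / 8)" if "r \<in> {0..<1}" for r
    using that by unfold_locales auto
  have "inj_on h {0..<1}"
  proof (rule linorder_inj_onI')
    fix r r' :: real assume r: "r \<in> {0..<1}" "r' \<in> {0..<1}" "r < r'"
    interpret a: real_frame "(r + 1) / 8" using frame r by blast
    interpret b: real_frame "(r' + 1) / 8" using frame r by blast
    obtain C :: "'a ra" where C: "algebra C" "identities C = identities a.line_algebra"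
      using ex_algebra_with_identities[OF a.algebra_line_algebra] .
    obtain D :: "'a ra" where D: "algebra D" "identities D = identities b.line_algebra"
      using ex_algebra_with_identities[OF b.algebra_line_algebra] .
    have "identities a.line_algebra \<noteq> identities b.line_algebra"
      using identities_line_algebra_inj[OF a.real_frame_axioms b.real_frame_axioms] r(3) by simp
    then have "C \<notin> h r' \<or> D \<notin> h r" by (auto simp: h_def in_models_iff C D)
    moreover have "C \<in> h r" "D \<in> h r'" by (simp_all add: h_def in_models_iff C D)
    ultimately show "h r \<noteq> h r'" by blast
  qed
  moreover have "h ` {0..<1} \<subseteq> ?J"
    using real_frame.line_variety_is_join_irreducible_cover[OF frame assms] by (auto simp: h_def)
  ultimately have "{0..<1::real} \<lesssim> ?J" unfolding lepoll_def by blast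
  with nat_sets_lepoll_reals01 show "(UNIV :: nat set set) \<lesssim> ?J" by (rule lepoll_trans)
qed

theorem theorem3p23:
  fixes U :: "'u set" and W :: "'a::infinite ra set"
  assumes "card U = 3"
    and "W = variety_generated_by (minimal_relation_algebra U)"
  shows "join_irreducible_covers (subvariety_lattice RSA) W \<approx> (UNIV :: nat set set)
       \<and> join_irreducible_covers (subvariety_lattice SA) W \<approx> (UNIV :: nat set set)
       \<and> join_irreducible_covers (subvariety_lattice NA) W \<approx> (UNIV :: nat set set)"
proof -
  have "W = models (identities four)"
    using minimal_relation_algebra_identities[OF assms(1)] assms(2) by (simp add: variety_generated_by_eq)
  moreover have "NA_axioms \<subseteq> SA_axioms" "SA_axioms \<subseteq> RSA_axioms"
    by (auto simp: SA_axioms_def RSA_axioms_def Let_def)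
  ultimately show ?thesis
    using join_irreducible_covers_eqpoll[OF RSA_eq_models] join_irreducible_covers_eqpoll[OF SA_eq_models]
      join_irreducible_covers_eqpoll[OF NA_eq_models] by auto
qed

end
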